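(* Let $\mathscr{C}$ be an extriangulated category. The assignments $\mathcal{X}\mapsto \mathbf{Filt}_{\mathscr{C}}(\mathcal{X})$ and $\mathcal{D}\mapsto \mathrm{sim}(\mathcal{D})$ give a one-to-one correspondence between the following two classes: (1) the class of simple semibricks $\mathcal{X}$ in $\mathscr{C}$; (2) the class of length wide subcategories $\mathcal{D}$ of $\mathscr{C}$.
   Context: Conventions: all categories are skeletally small, Hom-finite, Krull–Schmidt and $k$-linear over a fixed field $k$; subcategories are full and closed under isomorphisms; a set of (isoclasses of) objects is identified with the corresponding full subcategory. Extriangulated categories (Nakaoka–Palu). Let $\mathscr{C}$ be an additive category and $\mathbb{E}:\mathscr{C}^{op}\times\mathscr{C}\to Ab$ a biadditive functor; elements $\delta\in\mathbb{E}(C,A)$ are $\mathbb{E}$-extensions, and $a_*\delta=\mathbb{E}(C,a)(\delta)$, $c^*\delta=\mathbb{E}(c,A)(\delta)$. A morphism from $\delta\in\mathbb{E}(C,A)$ to $\delta'\in\mathbb{E}(C',A')$ is a pair $(a,c)$, $a:A\to A'$, $c:C\to C'$, with $a_*\delta=c^*\delta'$. Sequences $A\to B\to C$ and $A\to B'\to C$ are equivalent if there is an isomorphism $B\to B'$ compatible with the identities of $A$ and $C$. A realization $\mathfrak{s}$ assigns to each $\delta\in\mathbb{E}(C,A)$ an equivalence class $\mathfrak{s}(\delta)=[A\to B\to C]$ such that for each morphism $(a,c):\delta\to\delta'$ there is $b:B\to B'$ making $(a,b,c)$ a commutative diagram between representatives (then $(a,b,c)$ realizes $(a,c)$); it is additive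 if $\mathfrak{s}(0)=[A\to A\oplus C\to C]$ (split sequence) and $\mathfrak{s}(\delta\oplus\delta')=\mathfrak{s}(\delta)\oplus\mathfrak{s}(\delta')$. $(\mathscr{C},\mathbb{E},\mathfrak{s})$ is extriangulated if $\mathfrak{s}$ is an additive realization and: (ET3) for $\mathfrak{s}(\delta)=[A\xrightarrow{x}B\xrightarrow{y}C]$, $\mathfrak{s}(\delta')=[A'\xrightarrow{x'}B'\xrightarrow{y'}C']$ and $a,b$ with $bx=x'a$, there is $c$ such that $(a,c):\delta\to\delta'$ is a morphism realized by $(a,b,c)$; (ET3)$^{op}$ the dual; (ET4) for $\delta\in\mathbb{E}(D,A)$, $\delta'\in\mathbb{E}(F,B)$ realized by $A\xrightarrow{f}B\xrightarrow{f'}D$ and $B\xrightarrow{g}C\xrightarrow{g'}F$ there are an object $E$, morphisms $h=gf:A\to C$, $h':C\to E$, $d:D\to E$, $e:E\to F$ with $h'g=df'$, $eh'=g'$, and $\delta''\in\mathbb{E}(E,A)$ realized by $A\xrightarrow{h}C\xrightarrow{h'}E$ such that $D\xrightarrow{d}E\xrightarrow{e}F$ realizes $f'_*\delta'$, $d^*\delta''=\delta$ and $f_*\delta''=e^*\delta'$; (ET4)$^{op}$ the dual. If $\mathfrak{s}(\delta)=[A\xrightarrow{x}B\xrightarrow{y}C]$, then $A\xrightarrow{x}B\xrightarrow{y}C$ is a conflation, $x$ an inflation, $y$ a deflation, $A\to B\to C\stackrel{\delta}{\dashrightarrow}$ an $\mathbb{E}$-triangle, $C=\mathrm{cone}(x)$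 and $A=\mathrm{cocone}(y)$. A subcategory $\mathcal{D}$ is extension-closed (closed under extensions) if $\mathcal{D}*\mathcal{D}=\mathcal{D}$, where $\mathcal{D}*\mathcal{D}'$ is the subcategory of objects $X$ admitting an $\mathbb{E}$-triangle $D\to X\to D'\dashrightarrow$ with $D\in\mathcal{D}$, $D'\in\mathcal{D}'$. An extension-closed subcategory is itself an extriangulated category, with the restricted $\mathbb{E}$ and $\mathfrak{s}$. Filtration subcategory: for a collection $\mathcal{X}$ of objects of an extriangulated category $\mathscr{C}$, $\mathbf{Filt}_{\mathscr{C}}(\mathcal{X})$ consists of all objects $M$ admitting a finite filtration $0=X_0\xrightarrow{f_0}X_1\xrightarrow{f_1}\cdots\xrightarrow{f_{n-1}}X_n=M$ with each $f_i$ an inflation and $\mathrm{cone}(f_i)\in\mathcal{X}$. Semibricks: a brick is an object whose endomorphism ring is a division algebra; a semibrick is a set $\mathcal{X}$ of isoclasses of bricks with $\mathrm{Hom}(X_1,X_2)=0$ for any two non-isomorphic $X_1,X_2\in\mathcal{X}$. Simple objects: a nonzero object $M$ of an extriangulated category is simple if there is no $\mathbb{E}$-triangle $A\to M\to B\dashrightarrow$ in that category with $A,B\neq0$. $\mathrm{sim}(\mathcal{C})$ denotes the collection of isoclasses of simple objects of an extriangulated category $\mathcal{C}$. A set $\mathcal{X}$ of isoclasses of objects of $\mathscr{C}$ is simple if $\mathcal{X}\subseteq\mathrm{sim}(\mathbf{Filt}_{\mathscr{C}}(\mathcal{X}))$ (where $\mathbf{Filt}_{\mathscr{C}}(\mathcal{X})$,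 being extension-closed, is regarded as an extriangulated category). Wide and length subcategories: a morphism $f$ in an extriangulated category is admissible if $f=gh$ with $h$ a deflation and $g$ an inflation in that category. A subcategory $\mathcal{D}$ of $\mathscr{C}$ is wide if it is closed under extensions and every morphism in $\mathcal{D}$ is admissible in the extriangulated category $\mathcal{D}$. $\mathcal{D}$ is length if $\mathcal{D}=\mathbf{Filt}_{\mathcal{D}}(\mathrm{sim}(\mathcal{D}))$. *)

theory Defs
  imports "HOL-Algebra.Module"
begin

section \<open>Linear and additive categories\<close>

text \<open>
  \<open>Hom C A B\<close> is the \<open>k\<close>-module of morphisms from \<open>A\<close> to \<open>B\<close>, and \<open>Ext C Z A\<close> is the abelian
  group \<open>\<E>(Z, A)\<close>, written additively (its multiplication is irrelevant).
  \<open>push C a\<close> and \<open>pull C c\<close> are the maps \<open>\<delta> \<mapsto> a\<^sub>* \<delta>\<close> and \<open>\<delta> \<mapsto> c\<^sup>* \<delta>\<close>.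
  \<open>Real C Z A \<delta>\<close> is the equivalence class of sequences \<open>A \<rightarrow> B \<rightarrow> Z\<close> realizing
  \<open>\<delta> \<in> \<E>(Z, A)\<close>; a sequence is stored as the triple \<open>(x, B, y)\<close>.

  The objects form a set of HOL, so skeletal smallness needs no separate hypothesis. Composition,
  \<open>push\<close> and \<open>pull\<close> carry no object arguments: morphisms and extensions may be tagged with their
  end objects, so this loses no generality.
\<close>

record ('o, 'm, 'e, 'k) extcat =
  Ob :: "'o set"
  Hom :: "'o \<Rightarrow> 'o \<Rightarrow> ('k, 'm) module"
  Idn :: "'o \<Rightarrow> 'm"
  Cmp :: "'m \<Rightarrow> 'm \<Rightarrow> 'm" (infixl \<open>\<bullet>\<index>\<close> 70)
  Ext :: "'o \<Rightarrow> 'o \<Rightarrow> 'e ring"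
  push :: "'m \<Rightarrow> 'e \<Rightarrow> 'e"
  pull :: "'m \<Rightarrow> 'e \<Rightarrow> 'e"
  Real :: "'o \<Rightarrow> 'o \<Rightarrow> 'e \<Rightarrow> ('m \<times> 'o \<times> 'm) set"

abbreviation Mor :: "('o, 'm, 'e, 'k, 'z) extcat_scheme \<Rightarrow> 'o \<Rightarrow> 'o \<Rightarrow> 'm set" where
  "Mor C A B \<equiv> carrier (Hom C A B)"

abbreviation EE :: "('o, 'm, 'e, 'k, 'z) extcat_scheme \<Rightarrow> 'o \<Rightarrow> 'o \<Rightarrow> 'e set" where
  "EE C Z A \<equiv> carrier (Ext C Z A)"

locale linear_category =
  fixes K :: "('k, 'r) ring_scheme"
    and C :: "('o, 'm, 'e, 'k, 'z) extcat_scheme" (structure)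
  assumes base_field: "field K"
    and Hom_module: "\<lbrakk>A \<in> Ob C; B \<in> Ob C\<rbrakk> \<Longrightarrow> module K (Hom C A B)"
    and Idn_closed: "A \<in> Ob C \<Longrightarrow> Idn C A \<in> Mor C A A"
    and Cmp_closed: "\<lbrakk>A \<in> Ob C; B \<in> Ob C; Z \<in> Ob C; g \<in> Mor C B Z; f \<in> Mor C A B\<rbrakk>
      \<Longrightarrow> g \<bullet> f \<in> Mor C A Z"
    and Idn_left: "\<lbrakk>A \<in> Ob C; B \<in> Ob C; f \<in> Mor C A B\<rbrakk> \<Longrightarrow> Idn C B \<bullet> f = f"
    and Idn_right: "\<lbrakk>A \<in> Ob C; B \<in> Ob C; f \<in> Mor C A B\<rbrakk> \<Longrightarrow> f \<bullet> Idn C A = f"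
    and Cmp_assoc: "\<lbrakk>A \<in> Ob C; B \<in> Ob C; Z \<in> Ob C; W \<in> Ob C;
        h \<in> Mor C Z W; g \<in> Mor C B Z; f \<in> Mor C A B\<rbrakk> \<Longrightarrow> (h \<bullet> g) \<bullet> f = h \<bullet> (g \<bullet> f)"
    and Cmp_add_left: "\<lbrakk>A \<in> Ob C; B \<in> Ob C; Z \<in> Ob C;
        g \<in> Mor C B Z; g' \<in> Mor C B Z; f \<in> Mor C A B\<rbrakk>
      \<Longrightarrow> (g \<oplus>\<^bsub>Hom C B Z\<^esub> g') \<bullet> f = g \<bullet> f \<oplus>\<^bsub>Hom C A Z\<^esub> g' \<bullet> f"
    and Cmp_add_right: "\<lbrakk>A \<in> Ob C; B \<in> Ob C; Z \<in> Ob C;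
        g \<in> Mor C B Z; f \<in> Mor C A B; f' \<in> Mor C A B\<rbrakk>
      \<Longrightarrow> g \<bullet> (f \<oplus>\<^bsub>Hom C A B\<^esub> f') = g \<bullet> f \<oplus>\<^bsub>Hom C A Z\<^esub> g \<bullet> f'"
    and Cmp_smult_left: "\<lbrakk>A \<in> Ob C; B \<in> Ob C; Z \<in> Ob C;
        c \<in> carrier K; g \<in> Mor C B Z; f \<in> Mor C A B\<rbrakk>
      \<Longrightarrow> (c \<odot>\<^bsub>Hom C B Z\<^esub> g) \<bullet> f = c \<odot>\<^bsub>Hom C A Z\<^esub> (g \<bullet> f)"
    and Cmp_smult_right: "\<lbrakk>A \<in> Ob C; B \<in> Ob C; Z \<in> Ob C;
        c \<in> carrier K; g \<in> Mor C B Z; f \<in> Mor C A B\<rbrakk>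
      \<Longrightarrow> g \<bullet> (c \<odot>\<^bsub>Hom C A B\<^esub> f) = c \<odot>\<^bsub>Hom C A Z\<^esub> (g \<bullet> f)"

definition is_zero :: "('o, 'm, 'e, 'k, 'z) extcat_scheme \<Rightarrow> 'o \<Rightarrow> bool" where
  "is_zero C Z \<longleftrightarrow> Z \<in> Ob C \<and>
     (\<forall>A \<in> Ob C. (\<exists>!f. f \<in> Mor C A Z) \<and> (\<exists>!f. f \<in> Mor C Z A))"

definition is_iso :: "('o, 'm, 'e, 'k, 'z) extcat_scheme \<Rightarrow> 'o \<Rightarrow> 'o \<Rightarrow> 'm \<Rightarrow> bool" where
  "is_iso C A B f \<longleftrightarrow> f \<in> Mor C A B \<and>
     (\<exists>g \<in> Mor C B A. g \<bullet>\<^bsub>C\<^esub> f = Idn C A \<and> f \<bullet>\<^bsub>C\<^esub> g = Idn C B)"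

definition isomorphic :: "('o, 'm, 'e, 'k, 'z) extcat_scheme \<Rightarrow> 'o \<Rightarrow> 'o \<Rightarrow> bool" where
  "isomorphic C A B \<longleftrightarrow> (\<exists>f. is_iso C A B f)"

definition is_biproduct ::
  "('o, 'm, 'e, 'k, 'z) extcat_scheme \<Rightarrow> 'o \<Rightarrow> 'o \<Rightarrow> 'o \<Rightarrow> 'm \<Rightarrow> 'm \<Rightarrow> 'm \<Rightarrow> 'm \<Rightarrow> bool" where
  "is_biproduct C A B S i j p q \<longleftrightarrow> S \<in> Ob C \<and>
     i \<in> Mor C A S \<and> j \<in> Mor C B S \<and> p \<in> Mor C S A \<and> q \<in> Mor C S B \<and>
     p \<bullet>\<^bsub>C\<^esub> i = Idn C A \<and> q \<bullet>\<^bsub>C\<^esub> j = Idn C B \<and>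
     p \<bullet>\<^bsub>C\<^esub> j = \<zero>\<^bsub>Hom C B A\<^esub> \<and> q \<bullet>\<^bsub>C\<^esub> i = \<zero>\<^bsub>Hom C A B\<^esub> \<and>
     i \<bullet>\<^bsub>C\<^esub> p \<oplus>\<^bsub>Hom C S S\<^esub> j \<bullet>\<^bsub>C\<^esub> q = Idn C S"

locale additive_category = linear_category +
  assumes zero_object: "\<exists>Z. is_zero C Z"
    and biproducts: "\<lbrakk>A \<in> Ob C; B \<in> Ob C\<rbrakk> \<Longrightarrow> \<exists>S i j p q. is_biproduct C A B S i j p q"

definition hom_finite :: "('k, 'r) ring_scheme \<Rightarrow> ('o, 'm, 'e, 'k, 'z) extcat_scheme \<Rightarrow> bool" where
  "hom_finite K C \<longleftrightarrow> (\<forall>A \<in> Ob C. \<forall>B \<in> Ob C. \<exists>S. finite S \<and> S \<subseteq> Mor C A B \<and>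
     (\<forall>H. submodule H K (Hom C A B) \<longrightarrow> S \<subseteq> H \<longrightarrow> H = Mor C A B))"

definition End_ring :: "('o, 'm, 'e, 'k, 'z) extcat_scheme \<Rightarrow> 'o \<Rightarrow> 'm ring" where
  "End_ring C A = \<lparr>carrier = Mor C A A, mult = Cmp C, one = Idn C A,
     zero = \<zero>\<^bsub>Hom C A A\<^esub>, add = add (Hom C A A)\<rparr>"

definition local_ring :: "('a, 'z) ring_scheme \<Rightarrow> bool" where
  "local_ring R \<longleftrightarrow> ring R \<and> \<one>\<^bsub>R\<^esub> \<noteq> \<zero>\<^bsub>R\<^esub> \<and>
     (\<forall>a \<in> carrier R - Units R. \<forall>b \<in> carrier R - Units R. a \<oplus>\<^bsub>R\<^esub> b \<notin> Units R)"

text \<open>The case \<open>n = 0\<close> below covers the zero objects.\<close>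

definition krull_schmidt :: "('o, 'm, 'e, 'k, 'z) extcat_scheme \<Rightarrow> bool" where
  "krull_schmidt C \<longleftrightarrow> (\<forall>M \<in> Ob C. \<exists>(n::nat) X i p.
     (\<forall>j<n. X j \<in> Ob C \<and> local_ring (End_ring C (X j)) \<and>
        i j \<in> Mor C (X j) M \<and> p j \<in> Mor C M (X j)) \<and>
     (\<forall>j<n. \<forall>l<n. p j \<bullet>\<^bsub>C\<^esub> i l = (if j = l then Idn C (X j) else \<zero>\<^bsub>Hom C (X l) (X j)\<^esub>)) \<and>
     (\<Oplus>\<^bsub>Hom C M M\<^esub>j\<in>{..<n}. i j \<bullet>\<^bsub>C\<^esub> p j) = Idn C M)"


section \<open>Extriangulated categories\<close>

definition sequences :: "('o, 'm, 'e, 'k, 'z) extcat_scheme \<Rightarrow> 'o \<Rightarrow> 'o \<Rightarrow> ('m \<times> 'o \<times> 'm) set" where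
  "sequences C A Z = {(x, B, y). B \<in> Ob C \<and> x \<in> Mor C A B \<and> y \<in> Mor C B Z}"

definition seq_equiv ::
  "('o, 'm, 'e, 'k, 'z) extcat_scheme \<Rightarrow> 'o \<Rightarrow> 'o \<Rightarrow> (('m \<times> 'o \<times> 'm) \<times> ('m \<times> 'o \<times> 'm)) set" where
  "seq_equiv C A Z = {((x, B, y), (x', B', y')).
     (x, B, y) \<in> sequences C A Z \<and> (x', B', y') \<in> sequences C A Z \<and>
     (\<exists>b. is_iso C B B' b \<and> b \<bullet>\<^bsub>C\<^esub> x = x' \<and> y' \<bullet>\<^bsub>C\<^esub> b = y)}"

text \<open>
  In \<open>Real_sum\<close>, \<open>\<delta> \<oplus> \<delta>' \<in> \<E>(Z \<oplus> Z', A \<oplus> A')\<close> is \<open>i\<^sub>* p\<^sup>* \<delta> + i'\<^sub>* p'\<^sup>* \<delta>'\<close>, with \<open>i\<close>, \<open>i'\<close> the injections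
  into \<open>A \<oplus> A'\<close> and \<open>p\<close>, \<open>p'\<close> the projections from \<open>Z \<oplus> Z'\<close>. This is the element corresponding to
  \<open>(\<delta>, 0, 0, \<delta>')\<close> in \<open>\<E>(Z, A) \<oplus> \<E>(Z, A') \<oplus> \<E>(Z', A) \<oplus> \<E>(Z', A')\<close>.
\<close>

locale extriangulated_category = additive_category +
  assumes Ext_group: "\<lbrakk>Z \<in> Ob C; A \<in> Ob C\<rbrakk> \<Longrightarrow> abelian_group (Ext C Z A)"
    \<comment> \<open>\<open>\<E>\<close> is a biadditive functor\<close>
    and push_hom: "\<lbrakk>A \<in> Ob C; A' \<in> Ob C; Z \<in> Ob C; a \<in> Mor C A A'\<rbrakk>
      \<Longrightarrow> push C a \<in> hom (add_monoid (Ext C Z A)) (add_monoid (Ext C Z A'))"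
    and pull_hom: "\<lbrakk>A \<in> Ob C; Z \<in> Ob C; Z' \<in> Ob C; c \<in> Mor C Z' Z\<rbrakk>
      \<Longrightarrow> pull C c \<in> hom (add_monoid (Ext C Z A)) (add_monoid (Ext C Z' A))"
    and push_Idn: "\<lbrakk>A \<in> Ob C; Z \<in> Ob C; \<delta> \<in> EE C Z A\<rbrakk> \<Longrightarrow> push C (Idn C A) \<delta> = \<delta>"
    and pull_Idn: "\<lbrakk>A \<in> Ob C; Z \<in> Ob C; \<delta> \<in> EE C Z A\<rbrakk> \<Longrightarrow> pull C (Idn C Z) \<delta> = \<delta>"
    and push_Cmp: "\<lbrakk>A \<in> Ob C; A' \<in> Ob C; A'' \<in> Ob C; Z \<in> Ob C;
        a \<in> Mor C A A'; a' \<in> Mor C A' A''; \<delta> \<in> EE C Z A\<rbrakk>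
      \<Longrightarrow> push C (a' \<bullet> a) \<delta> = push C a' (push C a \<delta>)"
    and pull_Cmp: "\<lbrakk>A \<in> Ob C; Z \<in> Ob C; Z' \<in> Ob C; Z'' \<in> Ob C;
        c \<in> Mor C Z' Z; c' \<in> Mor C Z'' Z'; \<delta> \<in> EE C Z A\<rbrakk>
      \<Longrightarrow> pull C (c \<bullet> c') \<delta> = pull C c' (pull C c \<delta>)"
    and push_pull: "\<lbrakk>A \<in> Ob C; A' \<in> Ob C; Z \<in> Ob C; Z' \<in> Ob C;
        a \<in> Mor C A A'; c \<in> Mor C Z' Z; \<delta> \<in> EE C Z A\<rbrakk>
      \<Longrightarrow> push C a (pull C c \<delta>) = pull C c (push C a \<delta>)"
    and push_add: "\<lbrakk>A \<in> Ob C; A' \<in> Ob C; Z \<in> Ob C;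
        a \<in> Mor C A A'; a' \<in> Mor C A A'; \<delta> \<in> EE C Z A\<rbrakk>
      \<Longrightarrow> push C (a \<oplus>\<^bsub>Hom C A A'\<^esub> a') \<delta> = push C a \<delta> \<oplus>\<^bsub>Ext C Z A'\<^esub> push C a' \<delta>"
    and pull_add: "\<lbrakk>A \<in> Ob C; Z \<in> Ob C; Z' \<in> Ob C;
        c \<in> Mor C Z' Z; c' \<in> Mor C Z' Z; \<delta> \<in> EE C Z A\<rbrakk>
      \<Longrightarrow> pull C (c \<oplus>\<^bsub>Hom C Z' Z\<^esub> c') \<delta> = pull C c \<delta> \<oplus>\<^bsub>Ext C Z' A\<^esub> pull C c' \<delta>"
    \<comment> \<open>\<open>Real\<close> is an additive realization\<close>
    and Real_class: "\<lbrakk>A \<in> Ob C; Z \<in> Ob C; \<delta> \<in> EE C Z A\<rbrakk>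
      \<Longrightarrow> Real C Z A \<delta> \<in> sequences C A Z // seq_equiv C A Z"
    and Real_morphism: "\<lbrakk>A \<in> Ob C; Z \<in> Ob C; A' \<in> Ob C; Z' \<in> Ob C;
        \<delta> \<in> EE C Z A; \<delta>' \<in> EE C Z' A'; a \<in> Mor C A A'; c \<in> Mor C Z Z';
        push C a \<delta> = pull C c \<delta>';
        (x, B, y) \<in> Real C Z A \<delta>; (x', B', y') \<in> Real C Z' A' \<delta>'\<rbrakk>
      \<Longrightarrow> \<exists>b \<in> Mor C B B'. b \<bullet> x = x' \<bullet> a \<and> c \<bullet> y = y' \<bullet> b"
    and Real_zero: "\<lbrakk>A \<in> Ob C; Z \<in> Ob C; is_biproduct C A Z S i j p q\<rbrakk>
      \<Longrightarrow> (i, S, q) \<in> Real C Z A \<zero>\<^bsub>Ext C Z A\<^esub>"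
    and Real_sum: "\<lbrakk>A \<in> Ob C; Z \<in> Ob C; A' \<in> Ob C; Z' \<in> Ob C;
        \<delta> \<in> EE C Z A; \<delta>' \<in> EE C Z' A';
        (x, B, y) \<in> Real C Z A \<delta>; (x', B', y') \<in> Real C Z' A' \<delta>';
        is_biproduct C A A' SA iA iA' pA pA';
        is_biproduct C B B' SB iB iB' pB pB';
        is_biproduct C Z Z' SZ iZ iZ' pZ pZ'\<rbrakk>
      \<Longrightarrow> (iB \<bullet> x \<bullet> pA \<oplus>\<^bsub>Hom C SA SB\<^esub> iB' \<bullet> x' \<bullet> pA', SB,
           iZ \<bullet> y \<bullet> pB \<oplus>\<^bsub>Hom C SB SZ\<^esub> iZ' \<bullet> y' \<bullet> pB')
          \<in> Real C SZ SA (push C iA (pull C pZ \<delta>) \<oplus>\<^bsub>Ext C SZ SA\<^esub> push C iA' (pull C pZ' \<delta>'))"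
    and ET3: "\<lbrakk>A \<in> Ob C; Z \<in> Ob C; A' \<in> Ob C; Z' \<in> Ob C;
        \<delta> \<in> EE C Z A; \<delta>' \<in> EE C Z' A';
        (x, B, y) \<in> Real C Z A \<delta>; (x', B', y') \<in> Real C Z' A' \<delta>';
        a \<in> Mor C A A'; b \<in> Mor C B B'; b \<bullet> x = x' \<bullet> a\<rbrakk>
      \<Longrightarrow> \<exists>c \<in> Mor C Z Z'. push C a \<delta> = pull C c \<delta>' \<and> c \<bullet> y = y' \<bullet> b"
    and ET3_op: "\<lbrakk>A \<in> Ob C; Z \<in> Ob C; A' \<in> Ob C; Z' \<in> Ob C;
        \<delta> \<in> EE C Z A; \<delta>' \<in> EE C Z' A';
        (x, B, y) \<in> Real C Z A \<delta>; (x', B', y') \<in> Real C Z' A' \<delta>';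
        b \<in> Mor C B B'; c \<in> Mor C Z Z'; c \<bullet> y = y' \<bullet> b\<rbrakk>
      \<Longrightarrow> \<exists>a \<in> Mor C A A'. push C a \<delta> = pull C c \<delta>' \<and> b \<bullet> x = x' \<bullet> a"
    and ET4: "\<lbrakk>A \<in> Ob C; B \<in> Ob C; D \<in> Ob C; F \<in> Ob C;
        \<delta> \<in> EE C D A; \<delta>' \<in> EE C F B;
        (f, B, f') \<in> Real C D A \<delta>; (g, G, g') \<in> Real C F B \<delta>'\<rbrakk>
      \<Longrightarrow> \<exists>E \<in> Ob C. \<exists>h' \<in> Mor C G E. \<exists>d \<in> Mor C D E. \<exists>e \<in> Mor C E F. \<exists>\<delta>'' \<in> EE C E A.
            h' \<bullet> g = d \<bullet> f' \<and> e \<bullet> h' = g' \<and>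
            (g \<bullet> f, G, h') \<in> Real C E A \<delta>'' \<and>
            (d, E, e) \<in> Real C F D (push C f' \<delta>') \<and>
            pull C d \<delta>'' = \<delta> \<and> push C f \<delta>'' = pull C e \<delta>'"
    and ET4_op: "\<lbrakk>D \<in> Ob C; B \<in> Ob C; F \<in> Ob C; Z \<in> Ob C;
        \<delta> \<in> EE C B D; \<delta>' \<in> EE C Z F;
        (f', A, f) \<in> Real C B D \<delta>; (g', B, g) \<in> Real C Z F \<delta>'\<rbrakk>
      \<Longrightarrow> \<exists>E \<in> Ob C. \<exists>h' \<in> Mor C E A. \<exists>d \<in> Mor C D E. \<exists>e \<in> Mor C E F. \<exists>\<delta>'' \<in> EE C Z E.
            f \<bullet> h' = g' \<bullet> e \<and> h' \<bullet> d = f' \<and>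
            (h', A, g \<bullet> f) \<in> Real C Z E \<delta>'' \<and>
            (d, E, e) \<in> Real C F D (pull C g' \<delta>) \<and>
            push C e \<delta>'' = \<delta>' \<and> pull C g \<delta>'' = push C d \<delta>"

text \<open>
  All three objects of an \<open>\<E>\<close>-triangle have to lie in \<open>Ob C\<close>. This makes the following notions
  meaningful for the restriction of \<open>C\<close> to a full subcategory, see \<open>full_sub\<close>.
\<close>

definition etriangle ::
  "('o, 'm, 'e, 'k, 'z) extcat_scheme \<Rightarrow> 'o \<Rightarrow> 'm \<Rightarrow> 'o \<Rightarrow> 'm \<Rightarrow> 'o \<Rightarrow> 'e \<Rightarrow> bool" where
  "etriangle C A x B y Z \<delta> \<longleftrightarrow> A \<in> Ob C \<and> B \<in> Ob C \<and> Z \<in> Ob C \<and>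
     \<delta> \<in> EE C Z A \<and> (x, B, y) \<in> Real C Z A \<delta>"

definition conflation :: "('o, 'm, 'e, 'k, 'z) extcat_scheme \<Rightarrow> 'o \<Rightarrow> 'm \<Rightarrow> 'o \<Rightarrow> 'm \<Rightarrow> 'o \<Rightarrow> bool" where
  "conflation C A x B y Z \<longleftrightarrow> (\<exists>\<delta>. etriangle C A x B y Z \<delta>)"

definition inflation :: "('o, 'm, 'e, 'k, 'z) extcat_scheme \<Rightarrow> 'o \<Rightarrow> 'o \<Rightarrow> 'm \<Rightarrow> bool" where
  "inflation C A B x \<longleftrightarrow> (\<exists>y Z. conflation C A x B y Z)"

definition deflation :: "('o, 'm, 'e, 'k, 'z) extcat_scheme \<Rightarrow> 'o \<Rightarrow> 'o \<Rightarrow> 'm \<Rightarrow> bool" where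
  "deflation C B Z y \<longleftrightarrow> (\<exists>A x. conflation C A x B y Z)"

definition admissible :: "('o, 'm, 'e, 'k, 'z) extcat_scheme \<Rightarrow> 'o \<Rightarrow> 'o \<Rightarrow> 'm \<Rightarrow> bool" where
  "admissible C A B f \<longleftrightarrow>
     (\<exists>I h g. deflation C A I h \<and> inflation C I B g \<and> f = g \<bullet>\<^bsub>C\<^esub> h)"


section \<open>Subcategories, filtrations, simple objects and semibricks\<close>

text \<open>
  Full subcategories closed under isomorphisms, and likewise sets of isomorphism classes of objects,
  are given by isomorphism-closed sets of objects.
\<close>

definition iso_closed :: "('o, 'm, 'e, 'k, 'z) extcat_scheme \<Rightarrow> 'o set \<Rightarrow> bool" where
  "iso_closed C D \<longleftrightarrow> D \<subseteq> Ob C \<and> (\<forall>A \<in> D. \<forall>B \<in> Ob C. isomorphic C A B \<longrightarrow> B \<in> D)"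

definition star :: "('o, 'm, 'e, 'k, 'z) extcat_scheme \<Rightarrow> 'o set \<Rightarrow> 'o set \<Rightarrow> 'o set" where
  "star C D D' = {X. \<exists>A \<in> D. \<exists>Z \<in> D'. \<exists>x y. conflation C A x X y Z}"

text \<open>
  Subcategories are additive, so an extension-closed subcategory contains a zero object. Without this
  requirement the empty set would qualify, which is not an extriangulated category.
\<close>

definition extension_closed :: "('o, 'm, 'e, 'k, 'z) extcat_scheme \<Rightarrow> 'o set \<Rightarrow> bool" where
  "extension_closed C D \<longleftrightarrow> iso_closed C D \<and> (\<exists>Z \<in> D. is_zero C Z) \<and> star C D D = D"

text \<open>
  The restriction of the extriangulated structure to a full subcategory. The equivalence class
  \<open>Real C Z A \<delta>\<close> needs no change: if \<open>D\<close> is extension-closed and \<open>A\<close>, \<open>Z\<close> are in \<open>D\<close>, then the middle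
  terms of all its members are in \<open>D\<close>.
\<close>

definition full_sub ::
  "('o, 'm, 'e, 'k, 'z) extcat_scheme \<Rightarrow> 'o set \<Rightarrow> ('o, 'm, 'e, 'k, 'z) extcat_scheme" where
  "full_sub C D = C\<lparr>Ob := D\<rparr>"

definition Filt :: "('o, 'm, 'e, 'k, 'z) extcat_scheme \<Rightarrow> 'o set \<Rightarrow> 'o set" where
  "Filt C \<X> = {M. \<exists>(n::nat) X f. is_zero C (X 0) \<and> X n = M \<and>
     (\<forall>i<n. \<exists>y. \<exists>Z \<in> \<X>. conflation C (X i) (f i) (X (Suc i)) y Z)}"

definition is_simple :: "('o, 'm, 'e, 'k, 'z) extcat_scheme \<Rightarrow> 'o \<Rightarrow> bool" where
  "is_simple C M \<longleftrightarrow> M \<in> Ob C \<and> \<not> is_zero C M \<and>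
     \<not> (\<exists>A x y B. conflation C A x M y B \<and> \<not> is_zero C A \<and> \<not> is_zero C B)"

definition sim :: "('o, 'm, 'e, 'k, 'z) extcat_scheme \<Rightarrow> 'o set" where
  "sim C = {M. is_simple C M}"

definition division_ring :: "('a, 'z) ring_scheme \<Rightarrow> bool" where
  "division_ring R \<longleftrightarrow> ring R \<and> \<one>\<^bsub>R\<^esub> \<noteq> \<zero>\<^bsub>R\<^esub> \<and> Units R = carrier R - {\<zero>\<^bsub>R\<^esub>}"

definition brick :: "('o, 'm, 'e, 'k, 'z) extcat_scheme \<Rightarrow> 'o \<Rightarrow> bool" where
  "brick C M \<longleftrightarrow> M \<in> Ob C \<and> division_ring (End_ring C M)"

definition semibrick :: "('o, 'm, 'e, 'k, 'z) extcat_scheme \<Rightarrow> 'o set \<Rightarrow> bool" where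
  "semibrick C \<X> \<longleftrightarrow> iso_closed C \<X> \<and> (\<forall>M \<in> \<X>. brick C M) \<and>
     (\<forall>M \<in> \<X>. \<forall>N \<in> \<X>. \<not> isomorphic C M N \<longrightarrow> Mor C M N = {\<zero>\<^bsub>Hom C M N\<^esub>})"

definition simple_set :: "('o, 'm, 'e, 'k, 'z) extcat_scheme \<Rightarrow> 'o set \<Rightarrow> bool" where
  "simple_set C \<X> \<longleftrightarrow> iso_closed C \<X> \<and> \<X> \<subseteq> sim (full_sub C (Filt C \<X>))"

definition wide :: "('o, 'm, 'e, 'k, 'z) extcat_scheme \<Rightarrow> 'o set \<Rightarrow> bool" where
  "wide C D \<longleftrightarrow> extension_closed C D \<and>
     (\<forall>A \<in> D. \<forall>B \<in> D. \<forall>f \<in> Mor C A B. admissible (full_sub C D) A B f)"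

definition length_subcat :: "('o, 'm, 'e, 'k, 'z) extcat_scheme \<Rightarrow> 'o set \<Rightarrow> bool" where
  "length_subcat C D \<longleftrightarrow> iso_closed C D \<and> D = Filt (full_sub C D) (sim (full_sub C D))"

definition simple_semibricks :: "('o, 'm, 'e, 'k, 'z) extcat_scheme \<Rightarrow> 'o set set" where
  "simple_semibricks C = {\<X>. simple_set C \<X> \<and> semibrick C \<X>}"

definition length_wide_subcats :: "('o, 'm, 'e, 'k, 'z) extcat_scheme \<Rightarrow> 'o set set" where
  "length_wide_subcats C = {D. length_subcat C D \<and> wide C D}"

end

theory Submission
  imports Defs
begin

text \<open>
  Let \<open>\<D>\<close> be the filtration category of a simple semibrick \<open>\<X>\<close>, and let \<open>\<D>\<^sub>n\<close> consist of the objects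
  having a filtration with \<open>n\<close> factors in \<open>\<X>\<close>. Two facts control \<open>\<D>\<close>.

  First, every nonzero morphism \<open>M \<rightarrow> T\<close> from \<open>M \<in> \<D>\<^sub>n\<close> to \<open>T \<in> \<X>\<close> is a deflation with cocone in
  \<open>\<D>\<^sub>n\<^sub>-\<^sub>1\<close> (\<open>deflation_onto_generator\<close>): since \<open>\<X>\<close> is a semibrick, along a filtration the morphism
  either factors through the top factor, where it is an isomorphism, or is already a deflation on
  the previous step, and then \<open>T\<close> being a brick provides a splitting.

  Secondly, length is well behaved (\<open>retract_length_le\<close>): a retract \<open>M \<in> \<D>\<^sub>m\<close> of \<open>N \<in> \<D>\<^sub>n\<close> satisfies
  \<open>m \<le> n\<close>. One passes to the cocones of \<open>M \<rightarrow> T\<close> and \<open>N \<rightarrow> M \<rightarrow> T\<close>, which again form a retract. The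
  induction bottoms out at zero objects, and this is where simplicity enters: a conflation
  \<open>K \<rightarrow> 0 \<rightarrow> T\<close> with \<open>T \<in> \<X>\<close> would, added to \<open>T \<rightarrow> T \<rightarrow> 0\<close>, give a conflation
  \<open>T \<oplus> K \<rightarrow> T \<rightarrow> T\<close> contradicting simplicity of \<open>T\<close>. Consequently the length of an object is unique,
  and a deflation \<open>M \<rightarrow> T\<close> in \<open>\<D>\<close> is never zero, as otherwise \<open>M\<close> would be a retract of the
  shorter object \<open>K\<close> in \<open>K \<rightarrow> M \<rightarrow> T\<close>.

  Inflations need not be monic in \<open>\<D>\<close>, so kernels and cokernels are not available to show that
  every \<open>f : M \<rightarrow> N\<close> in \<open>\<D>\<close> is admissible. Instead \<open>admissible_in_Filt\<close> uses induction on the sum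
  of the lengths. If some nonzero \<open>t : N \<rightarrow> T\<close> kills \<open>f\<close>, then \<open>f\<close> factors through the cocone of
  \<open>t\<close>. Otherwise any nonzero \<open>t : N \<rightarrow> T\<close> induces \<open>c : M\<^sub>1 \<rightarrow> N\<^sub>1\<close> on the cocones of \<open>t f\<close> and \<open>t\<close>,
  and \<open>c\<close> has an admissible factorization \<open>M\<^sub>1 \<rightarrow> I \<rightarrow> N\<^sub>1\<close> with cocone \<open>K\<close> and cone \<open>Q\<close>. A nonzero \<open>Q\<close>
  would yield a nonzero morphism from \<open>N\<close> to a brick killing \<open>f\<close>; a nonzero \<open>K\<close> lets \<open>f\<close> factor
  through the shorter cone of \<open>K \<rightarrow> M\<close>; and if both vanish, then \<open>c\<close> and hence \<open>f\<close> are isomorphisms.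

  Conversely, in a wide subcategory an admissible factorization of a nonzero morphism between
  simple objects has zero cocone and zero cone, so the simple objects form a semibrick
  (\<open>simple_in_wide_iso\<close>). That the two assignments are mutually inverse is then formal: a simple
  object of \<open>\<D>\<close> has a filtration of length one, and for an extension-closed subcategory containing
  the factors it makes no difference whether filtrations are formed in it or in the whole category.
\<close>

section \<open>Linear categories\<close>

context linear_category
begin

text \<open>
  Composition carries no objects, so the typing of a composite depends on membership of all three
  objects involved. Bundling these conditions lets typing facts be chained by resolution.
\<close>

definition arr :: "'m \<Rightarrow> 'o \<Rightarrow> 'o \<Rightarrow> bool" where
  "arr f A B \<longleftrightarrow> A \<in> Ob C \<and> B \<in> Ob C \<and> f \<in> Mor C A B"

lemma arrI: "\<lbrakk>A \<in> Ob C; B \<in> Ob C; f \<in> Mor C A B\<rbrakk> \<Longrightarrow> arr f A B"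
  by (simp add: arr_def)

lemma Hom_abelian_group: "\<lbrakk>A \<in> Ob C; B \<in> Ob C\<rbrakk> \<Longrightarrow> abelian_group (Hom C A B)"
  using Hom_module module_def by blast

lemma arr_Idn: "A \<in> Ob C \<Longrightarrow> arr (Idn C A) A A"
  by (simp add: arr_def Idn_closed)

lemma arr_zero: "\<lbrakk>A \<in> Ob C; B \<in> Ob C\<rbrakk> \<Longrightarrow> arr \<zero>\<^bsub>Hom C A B\<^esub> A B"
  using abelian_group.axioms(1)[OF Hom_abelian_group]
  by (simp add: arr_def abelian_monoid.zero_closed)

lemma arr_diff: "\<lbrakk>arr f A B; arr g A B\<rbrakk> \<Longrightarrow> arr (f \<ominus>\<^bsub>Hom C A B\<^esub> g) A B"
  using abelian_group.minus_closed[OF Hom_abelian_group] by (simp add: arr_def)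

lemma arr_Cmp: "\<lbrakk>arr g B Z; arr f A B\<rbrakk> \<Longrightarrow> arr (g \<bullet> f) A Z"
  by (auto simp: arr_def intro: Cmp_closed)

lemma arr_Cmp_assoc: "\<lbrakk>arr h Z W; arr g B Z; arr f A B\<rbrakk> \<Longrightarrow> (h \<bullet> g) \<bullet> f = h \<bullet> (g \<bullet> f)"
  using Cmp_assoc[of A B Z W h g f] by (simp add: arr_def)

lemma arr_Idn_left: "arr f A B \<Longrightarrow> Idn C B \<bullet> f = f"
  using Idn_left[of A B f] by (simp add: arr_def)

lemma arr_Idn_right: "arr f A B \<Longrightarrow> f \<bullet> Idn C A = f"
  using Idn_right[of A B f] by (simp add: arr_def)

lemma arr_add_left:
  "\<lbrakk>arr g B Z; arr g' B Z; arr f A B\<rbrakk> \<Longrightarrow> (g \<oplus>\<^bsub>Hom C B Z\<^esub> g') \<bullet> f = g \<bullet> f \<oplus>\<^bsub>Hom C A Z\<^esub> g' \<bullet> f"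
  using Cmp_add_left[of A B Z g g' f] by (simp add: arr_def)

lemma arr_add_right:
  "\<lbrakk>arr g B Z; arr f A B; arr f' A B\<rbrakk> \<Longrightarrow> g \<bullet> (f \<oplus>\<^bsub>Hom C A B\<^esub> f') = g \<bullet> f \<oplus>\<^bsub>Hom C A Z\<^esub> g \<bullet> f'"
  using Cmp_add_right[of A B Z g f f'] by (simp add: arr_def)

lemma
  assumes "arr f A B"
  shows arr_add_zero: "f \<oplus>\<^bsub>Hom C A B\<^esub> \<zero>\<^bsub>Hom C A B\<^esub> = f"
    and arr_diff_zero: "f \<ominus>\<^bsub>Hom C A B\<^esub> \<zero>\<^bsub>Hom C A B\<^esub> = f"
    and arr_double_eq_iff: "f \<oplus>\<^bsub>Hom C A B\<^esub> f = f \<longleftrightarrow> f = \<zero>\<^bsub>Hom C A B\<^esub>"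
proof -
  interpret H: abelian_group "Hom C A B" using assms Hom_abelian_group by (simp add: arr_def)
  have c: "f \<in> carrier (Hom C A B)" using assms by (auto simp: arr_def)
  show "f \<oplus>\<^bsub>Hom C A B\<^esub> \<zero>\<^bsub>Hom C A B\<^esub> = f" using c by simp
  show "f \<ominus>\<^bsub>Hom C A B\<^esub> \<zero>\<^bsub>Hom C A B\<^esub> = f" using c by (simp add: H.minus_eq)
  show "f \<oplus>\<^bsub>Hom C A B\<^esub> f = f \<longleftrightarrow> f = \<zero>\<^bsub>Hom C A B\<^esub>" using c H.add.l_cancel_one' by auto
qed

lemma
  assumes "arr f A B" "arr g A B"
  shows arr_diff_add: "(f \<ominus>\<^bsub>Hom C A B\<^esub> g) \<oplus>\<^bsub>Hom C A B\<^esub> g = f"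
    and arr_add_diff: "g \<oplus>\<^bsub>Hom C A B\<^esub> (f \<ominus>\<^bsub>Hom C A B\<^esub> g) = f"
    and arr_add_diff_cancel: "(f \<oplus>\<^bsub>Hom C A B\<^esub> g) \<ominus>\<^bsub>Hom C A B\<^esub> g = f"
    and arr_diff_eq_zero_iff: "f \<ominus>\<^bsub>Hom C A B\<^esub> g = \<zero>\<^bsub>Hom C A B\<^esub> \<longleftrightarrow> f = g"
    and arr_add_commute: "f \<oplus>\<^bsub>Hom C A B\<^esub> g = g \<oplus>\<^bsub>Hom C A B\<^esub> f"
proof -
  interpret H: abelian_group "Hom C A B" using assms Hom_abelian_group by (simp add: arr_def)
  have c: "f \<in> carrier (Hom C A B)" "g \<in> carrier (Hom C A B)" using assms by (auto simp: arr_def)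
  show "f \<oplus>\<^bsub>Hom C A B\<^esub> g = g \<oplus>\<^bsub>Hom C A B\<^esub> f" using c by (simp add: H.a_comm)
  show d: "(f \<ominus>\<^bsub>Hom C A B\<^esub> g) \<oplus>\<^bsub>Hom C A B\<^esub> g = f"
    using c by (simp add: H.minus_eq H.a_assoc H.l_neg)
  then show "g \<oplus>\<^bsub>Hom C A B\<^esub> (f \<ominus>\<^bsub>Hom C A B\<^esub> g) = f" using c H.a_comm by (metis H.minus_closed)
  show "(f \<oplus>\<^bsub>Hom C A B\<^esub> g) \<ominus>\<^bsub>Hom C A B\<^esub> g = f"
    using c by (simp add: H.minus_eq H.a_assoc H.r_neg)
  show "f \<ominus>\<^bsub>Hom C A B\<^esub> g = \<zero>\<^bsub>Hom C A B\<^esub> \<longleftrightarrow> f = g"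
    using c d H.l_zero H.r_neg by (metis H.minus_eq)
qed

lemma zero_Cmp: "\<lbrakk>arr f A B; Z \<in> Ob C\<rbrakk> \<Longrightarrow> \<zero>\<^bsub>Hom C B Z\<^esub> \<bullet> f = \<zero>\<^bsub>Hom C A Z\<^esub>"
  using arr_add_left[of "\<zero>\<^bsub>Hom C B Z\<^esub>" B Z "\<zero>\<^bsub>Hom C B Z\<^esub>" f A]
    arr_add_zero[OF arr_zero, of B Z]
    arr_double_eq_iff[of "\<zero>\<^bsub>Hom C B Z\<^esub> \<bullet> f" A Z] arr_zero[of B Z]
    arr_Cmp[of "\<zero>\<^bsub>Hom C B Z\<^esub>" B Z f A]
  by (auto simp: arr_def)

lemma Cmp_zero: "\<lbrakk>arr g B Z; A \<in> Ob C\<rbrakk> \<Longrightarrow> g \<bullet> \<zero>\<^bsub>Hom C A B\<^esub> = \<zero>\<^bsub>Hom C A Z\<^esub>"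
  using arr_add_right[of g B Z "\<zero>\<^bsub>Hom C A B\<^esub>" A "\<zero>\<^bsub>Hom C A B\<^esub>"]
    arr_add_zero[OF arr_zero, of A B]
    arr_double_eq_iff[of "g \<bullet> \<zero>\<^bsub>Hom C A B\<^esub>" A Z] arr_zero[of A B]
    arr_Cmp[of g B Z "\<zero>\<^bsub>Hom C A B\<^esub>" A]
  by (auto simp: arr_def)

lemma diff_Cmp:
  assumes "arr g B Z" "arr g' B Z" "arr f A B"
  shows "(g \<ominus>\<^bsub>Hom C B Z\<^esub> g') \<bullet> f = g \<bullet> f \<ominus>\<^bsub>Hom C A Z\<^esub> g' \<bullet> f"
proof -
  have "(g \<ominus>\<^bsub>Hom C B Z\<^esub> g') \<bullet> f \<oplus>\<^bsub>Hom C A Z\<^esub> g' \<bullet> f = g \<bullet> f"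
    using arr_add_left[OF arr_diff, OF assms(1,2,2,3)] arr_diff_add[OF assms(1,2)] by simp
  then show ?thesis
    using arr_add_diff_cancel[OF arr_Cmp[OF arr_diff[OF assms(1,2)] assms(3)] arr_Cmp[OF assms(2,3)]]
    by simp
qed

lemma Cmp_diff:
  assumes "arr g B Z" "arr f A B" "arr f' A B"
  shows "g \<bullet> (f \<ominus>\<^bsub>Hom C A B\<^esub> f') = g \<bullet> f \<ominus>\<^bsub>Hom C A Z\<^esub> g \<bullet> f'"
proof -
  have "g \<bullet> (f \<ominus>\<^bsub>Hom C A B\<^esub> f') \<oplus>\<^bsub>Hom C A Z\<^esub> g \<bullet> f' = g \<bullet> f"
    using arr_add_right[OF assms(1) arr_diff[OF assms(2,3)] assms(3)]
      arr_diff_add[OF assms(2,3)] by simp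
  then show ?thesis
    using arr_add_diff_cancel[OF arr_Cmp[OF assms(1) arr_diff[OF assms(2,3)]] arr_Cmp[OF assms(1,3)]]
    by simp
qed

text \<open>
  With its dual, this turns a morphism of sequences and one in the opposite direction into an
  endomorphism that is the identity on the outer terms, the situation of the five-lemma.
\<close>

lemma round_trip_left:
  assumes "arr x A B" "arr x' A' B'" "arr a A A'" "arr a' A' A" "arr b B B'" "arr b' B' B"
    and "b \<bullet> x = x' \<bullet> a" "b' \<bullet> x' = x \<bullet> a'" "a' \<bullet> a = Idn C A"
  shows "(b' \<bullet> b) \<bullet> x = x"
  using arr_Cmp_assoc[OF assms(6,5,1)] arr_Cmp_assoc[OF assms(6,2,3)] arr_Cmp_assoc[OF assms(1,4,3)]
    arr_Idn_right[OF assms(1)] assms(7-9) by simp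

lemma round_trip_right:
  assumes "arr y B Z" "arr y' B' Z'" "arr c Z Z'" "arr c' Z' Z" "arr b B B'" "arr b' B' B"
    and "c \<bullet> y = y' \<bullet> b" "c' \<bullet> y' = y \<bullet> b'" "c' \<bullet> c = Idn C Z"
  shows "y \<bullet> (b' \<bullet> b) = y"
  using arr_Cmp_assoc[OF assms(1,6,5)] arr_Cmp_assoc[OF assms(4,2,5)] arr_Cmp_assoc[OF assms(4,3,1)]
    arr_Idn_left[OF assms(1)] assms(7-9) by simp

section \<open>Isomorphisms and zero objects\<close>

lemma is_isoI:
  assumes "arr f A B" "arr g B A" "g \<bullet> f = Idn C A" "f \<bullet> g = Idn C B"
  shows "is_iso C A B f"
  using assms by (auto simp: is_iso_def arr_def)

lemma is_isoE:
  assumes "is_iso C A B f" "A \<in> Ob C" "B \<in> Ob C"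
  obtains g where "arr f A B" "arr g B A" "g \<bullet> f = Idn C A" "f \<bullet> g = Idn C B" "is_iso C B A g"
  using assms by (auto simp: is_iso_def arr_def)

lemma is_iso_Idn: "A \<in> Ob C \<Longrightarrow> is_iso C A A (Idn C A)"
  using is_isoI[OF arr_Idn arr_Idn] arr_Idn_left[OF arr_Idn] by blast

lemma is_iso_Cmp:
  assumes "is_iso C A B f" "is_iso C B Z g" "A \<in> Ob C" "B \<in> Ob C" "Z \<in> Ob C"
  shows "is_iso C A Z (g \<bullet> f)"
proof -
  obtain f' where f: "arr f A B" "arr f' B A" "f' \<bullet> f = Idn C A" "f \<bullet> f' = Idn C B"
    using is_isoE assms by metis
  obtain g' where g: "arr g B Z" "arr g' Z B" "g' \<bullet> g = Idn C B" "g \<bullet> g' = Idn C Z"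
    using is_isoE assms by metis
  have "(f' \<bullet> g') \<bullet> (g \<bullet> f) = f' \<bullet> ((g' \<bullet> g) \<bullet> f)"
    using arr_Cmp_assoc[OF f(2) g(2) arr_Cmp[OF g(1) f(1)]] arr_Cmp_assoc[OF g(2,1) f(1)] by simp
  moreover have "(g \<bullet> f) \<bullet> (f' \<bullet> g') = g \<bullet> ((f \<bullet> f') \<bullet> g')"
    using arr_Cmp_assoc[OF g(1) f(1) arr_Cmp[OF f(2) g(2)]] arr_Cmp_assoc[OF f(1,2) g(2)] by simp
  ultimately show ?thesis
    using f g by (intro is_isoI[OF arr_Cmp[OF g(1) f(1)] arr_Cmp[OF f(2) g(2)]]) (auto simp: arr_Idn_left)
qed

lemma is_iso_if_both_composites_iso:
  assumes "arr f A B" "arr g B A" "is_iso C A A (g \<bullet> f)" "is_iso C B B (f \<bullet> g)"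
  shows "is_iso C A B f"
proof -
  have AB: "A \<in> Ob C" "B \<in> Ob C" using assms by (auto simp: arr_def)
  obtain u where u: "arr u A A" "u \<bullet> (g \<bullet> f) = Idn C A" using is_isoE assms AB by metis
  obtain v where v: "arr v B B" "(f \<bullet> g) \<bullet> v = Idn C B" using is_isoE assms AB by metis
  define l r where "l = u \<bullet> g" and "r = g \<bullet> v"
  have l: "arr l B A" "l \<bullet> f = Idn C A" using u assms by (auto simp: l_def arr_Cmp arr_Cmp_assoc)
  have r: "arr r B A" "f \<bullet> r = Idn C B"
    using v assms arr_Cmp_assoc[OF assms(1,2) v(1)] by (auto simp: r_def intro: arr_Cmp)
  have "l = l \<bullet> (f \<bullet> r)" using r l by (simp add: arr_Idn_right)
  also have "\<dots> = r" using arr_Cmp_assoc[OF l(1) assms(1) r(1)] l r by (simp add: arr_Idn_left)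
  finally show ?thesis using l r assms is_isoI by metis
qed

text \<open>
  If \<open>b = 1 + n\<close> with \<open>n\<^sup>2 = 0\<close>, then \<open>1 - n\<close> is the inverse of \<open>b\<close>. This replaces the long exact
  sequences in the proofs of the five-lemmas below.
\<close>

lemma is_iso_if_square_zero_deviation:
  assumes b: "arr b A A" and n: "n = b \<ominus>\<^bsub>Hom C A A\<^esub> Idn C A"
    and nn: "n \<bullet> n = \<zero>\<^bsub>Hom C A A\<^esub>"
  shows "is_iso C A A b"
proof -
  have A: "A \<in> Ob C" using b by (simp add: arr_def)
  note id = arr_Idn[OF A]
  have an: "arr n A A" unfolding n by (rule arr_diff[OF b id])
  define m where "m = Idn C A \<ominus>\<^bsub>Hom C A A\<^esub> n"
  have am: "arr m A A" unfolding m_def by (rule arr_diff[OF id an])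
  have bn: "b = Idn C A \<oplus>\<^bsub>Hom C A A\<^esub> n" unfolding n by (simp add: arr_add_diff[OF b id])
  have nm: "n \<bullet> m = n" "m \<bullet> n = n"
    unfolding m_def using an id nn
    by (simp_all add: Cmp_diff[OF an id an] diff_Cmp[OF id an an] arr_Idn_left[OF an]
        arr_Idn_right[OF an] arr_diff_zero[OF an])
  have "b \<bullet> m = Idn C A" "m \<bullet> b = Idn C A"
    unfolding bn arr_add_left[OF id an am] arr_add_right[OF am id an] nm
      arr_Idn_left[OF am] arr_Idn_right[OF am]
    by (simp_all add: m_def arr_diff_add[OF id an])
  then show ?thesis using is_isoI[OF b am] by blast
qed

lemma is_zero_iff: "is_zero C Z \<longleftrightarrow> Z \<in> Ob C \<and> Idn C Z = \<zero>\<^bsub>Hom C Z Z\<^esub>"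
proof
  assume "is_zero C Z"
  then show "Z \<in> Ob C \<and> Idn C Z = \<zero>\<^bsub>Hom C Z Z\<^esub>"
    using arr_Idn[of Z] arr_zero[of Z Z] by (auto simp: is_zero_def arr_def)
next
  assume a: "Z \<in> Ob C \<and> Idn C Z = \<zero>\<^bsub>Hom C Z Z\<^esub>"
  have "f = \<zero>\<^bsub>Hom C A Z\<^esub>" if "arr f A Z" for f A
    using a that zero_Cmp[OF that] arr_Idn_left[OF that] by simp
  moreover have "f = \<zero>\<^bsub>Hom C Z A\<^esub>" if "arr f Z A" for f A
    using a that Cmp_zero[OF that] arr_Idn_right[OF that] by simp
  ultimately show "is_zero C Z"
    unfolding is_zero_def using a arr_zero by (simp add: arr_def) metis
qed

lemma arr_from_zero: "\<lbrakk>is_zero C Z; arr f Z A\<rbrakk> \<Longrightarrow> f = \<zero>\<^bsub>Hom C Z A\<^esub>"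
  using arr_zero[of Z A] by (auto simp: is_zero_def arr_def)

lemma arr_to_zero: "\<lbrakk>is_zero C Z; arr f A Z\<rbrakk> \<Longrightarrow> f = \<zero>\<^bsub>Hom C A Z\<^esub>"
  using arr_zero[of A Z] by (auto simp: is_zero_def arr_def)

lemma is_zero_retract:
  assumes "is_zero C Z" "arr i A Z" "arr r Z A" "r \<bullet> i = Idn C A"
  shows "is_zero C A"
proof -
  have A: "A \<in> Ob C" using assms by (simp add: arr_def)
  show ?thesis
    using arr_to_zero[OF assms(1,2)] Cmp_zero[OF assms(3) A] assms(4) A by (simp add: is_zero_iff)
qed

lemma is_zero_iso:
  assumes "is_zero C A" "is_iso C A B f" "B \<in> Ob C"
  shows "is_zero C B"
proof -
  have "A \<in> Ob C" using assms(1) by (simp add: is_zero_iff)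
  then show ?thesis using is_isoE[OF assms(2)] assms(3) is_zero_retract[OF assms(1)] by metis
qed

lemma is_biproduct_commute:
  assumes "is_biproduct C A B S i j p q" "A \<in> Ob C" "B \<in> Ob C"
  shows "is_biproduct C B A S j i q p"
proof -
  have "arr (i \<bullet> p) S S" "arr (j \<bullet> q) S S"
    using assms arr_Cmp by (auto simp: is_biproduct_def arr_def intro: Cmp_closed)
  then show ?thesis using assms arr_add_commute[of "i \<bullet> p" S S "j \<bullet> q"]
    by (auto simp: is_biproduct_def)
qed

lemma is_biproduct_iso_zero:
  assumes "is_iso C A B f" "A \<in> Ob C" "is_zero C Z" "B \<in> Ob C" and g: "arr g B A" "g \<bullet> f = Idn C A" "f \<bullet> g = Idn C B"
  shows "is_biproduct C A Z B f \<zero>\<^bsub>Hom C Z B\<^esub> g \<zero>\<^bsub>Hom C B Z\<^esub>"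
proof -
  have Z: "Z \<in> Ob C" "Idn C Z = \<zero>\<^bsub>Hom C Z Z\<^esub>" using assms(3) by (auto simp: is_zero_iff)
  have f: "arr f A B" using assms by (auto simp: is_iso_def arr_def)
  note z = arr_zero[OF assms(4) Z(1)] arr_zero[OF Z(1) assms(4)]
  show ?thesis
    unfolding is_biproduct_def
    using assms(4) f g z Z assms(2)
    by (auto simp: arr_def[of f] arr_def[of g] zero_Cmp[OF z(2)] Cmp_zero[OF g(1)] zero_Cmp[OF f]
        zero_Cmp[OF z(1)] arr_add_zero[OF arr_Idn]) (auto simp: arr_def)
qed

end

section \<open>Exactness properties of extriangulated categories\<close>

context extriangulated_category
begin

lemma push_closed:
  assumes "arr a A A'" "Z \<in> Ob C" "\<delta> \<in> EE C Z A"
  shows "push C a \<delta> \<in> EE C Z A'"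
  using hom_in_carrier[OF push_hom[of A A' Z a]] assms by (simp add: arr_def)

lemma pull_closed:
  assumes "arr c Z' Z" "A \<in> Ob C" "\<delta> \<in> EE C Z A"
  shows "pull C c \<delta> \<in> EE C Z' A"
  using hom_in_carrier[OF pull_hom[of A Z Z' c]] assms by (simp add: arr_def)

lemma Ext_zero_closed: "\<lbrakk>Z \<in> Ob C; A \<in> Ob C\<rbrakk> \<Longrightarrow> \<zero>\<^bsub>Ext C Z A\<^esub> \<in> EE C Z A"
  using abelian_group.axioms(1)[OF Ext_group] by (simp add: abelian_monoid.zero_closed)

lemma push_Ext_zero:
  assumes "arr a A A'" "Z \<in> Ob C"
  shows "push C a \<zero>\<^bsub>Ext C Z A\<^esub> = \<zero>\<^bsub>Ext C Z A'\<^esub>"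
  using hom_one[OF push_hom[of A A' Z a] abelian_group.a_group abelian_group.a_group,
      OF _ _ _ _ Ext_group Ext_group] assms by (simp add: arr_def)

lemma pull_Ext_zero:
  assumes "arr c Z' Z" "A \<in> Ob C"
  shows "pull C c \<zero>\<^bsub>Ext C Z A\<^esub> = \<zero>\<^bsub>Ext C Z' A\<^esub>"
  using hom_one[OF pull_hom[of A Z Z' c] abelian_group.a_group abelian_group.a_group,
      OF _ _ _ _ Ext_group Ext_group] assms by (simp add: arr_def)

lemma push_diff_eq_zero:
  assumes "arr a A A'" "arr a' A A'" "Z \<in> Ob C" "\<delta> \<in> EE C Z A" "push C a \<delta> = push C a' \<delta>"
  shows "push C (a \<ominus>\<^bsub>Hom C A A'\<^esub> a') \<delta> = \<zero>\<^bsub>Ext C Z A'\<^esub>"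
proof -
  have ob: "A \<in> Ob C" "A' \<in> Ob C" using assms by (auto simp: arr_def)
  interpret E: abelian_group "Ext C Z A'" using Ext_group ob assms by simp
  note d = arr_diff[OF assms(1,2)]
  have "push C a \<delta> = push C (a \<ominus>\<^bsub>Hom C A A'\<^esub> a') \<delta> \<oplus>\<^bsub>Ext C Z A'\<^esub> push C a' \<delta>"
    using push_add[OF ob assms(3) _ _ assms(4), of "a \<ominus>\<^bsub>Hom C A A'\<^esub> a'" a'] d assms(1,2)
      arr_diff_add[OF assms(1,2)] by (simp add: arr_def)
  then show ?thesis
    using E.add.r_cancel_one'[OF push_closed[OF assms(2,3,4)] push_closed[OF d assms(3,4)]]
      assms(5) by simp
qed

lemma push_zero_map:
  assumes "A \<in> Ob C" "A' \<in> Ob C" "Z \<in> Ob C" "\<delta> \<in> EE C Z A"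
  shows "push C \<zero>\<^bsub>Hom C A A'\<^esub> \<delta> = \<zero>\<^bsub>Ext C Z A'\<^esub>"
  using push_diff_eq_zero[OF arr_zero arr_zero, OF assms(1,2,1,2,3,4)]
    arr_diff_zero[OF arr_zero, OF assms(1,2)] by simp

lemma Real_subset_sequences:
  assumes "A \<in> Ob C" "Z \<in> Ob C" "\<delta> \<in> EE C Z A"
  shows "Real C Z A \<delta> \<subseteq> sequences C A Z"
  using Real_class[OF assms] by (auto simp: quotient_def seq_equiv_def)

lemma etriangleD:
  assumes "etriangle C A x B y Z \<delta>"
  shows "A \<in> Ob C" "B \<in> Ob C" "Z \<in> Ob C" "arr x A B" "arr y B Z" "\<delta> \<in> EE C Z A"
    "(x, B, y) \<in> Real C Z A \<delta>"
  using assms Real_subset_sequences[of A Z \<delta>]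
  by (auto simp: etriangle_def sequences_def arr_def)

lemma etriangleI:
  assumes "A \<in> Ob C" "Z \<in> Ob C" "\<delta> \<in> EE C Z A" "(x, B, y) \<in> Real C Z A \<delta>"
  shows "etriangle C A x B y Z \<delta>"
  using assms Real_subset_sequences[of A Z \<delta>] by (auto simp: etriangle_def sequences_def)

lemma conflationD:
  assumes "conflation C A x B y Z"
  shows "A \<in> Ob C" "B \<in> Ob C" "Z \<in> Ob C" "arr x A B" "arr y B Z"
  using assms etriangleD by (auto simp: conflation_def)

lemma realization_exists:
  assumes "A \<in> Ob C" "Z \<in> Ob C" "\<delta> \<in> EE C Z A"
  obtains x B y where "etriangle C A x B y Z \<delta>"
proof -
  obtain x B y where s: "(x, B, y) \<in> sequences C A Z" "Real C Z A \<delta> = seq_equiv C A Z `` {(x, B, y)}"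
    using Real_class[OF assms] by (auto simp: quotient_def)
  have B: "arr x A B" "arr y B Z" "B \<in> Ob C" using s assms by (auto simp: sequences_def arr_def)
  have "(x, B, y) \<in> Real C Z A \<delta>"
    using s is_iso_Idn[OF B(3)] arr_Idn_left[OF B(1)] arr_Idn_right[OF B(2)]
    by (auto simp: seq_equiv_def)
  then show thesis using that etriangleI assms by blast
qed

text \<open>
  A realization is a full equivalence class of sequences, so it may be transported along
  isomorphisms of the middle term.
\<close>

lemma etriangle_iso_mid:
  assumes t: "etriangle C A x B y Z \<delta>" and b: "is_iso C B B' b" "B' \<in> Ob C"
    and x': "b \<bullet> x = x'" and y': "y' \<bullet> b = y" "arr y' B' Z"
  shows "etriangle C A x' B' y' Z \<delta>"
proof -
  note d = etriangleD[OF t]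
  obtain x0 B0 y0 where s: "(x0, B0, y0) \<in> sequences C A Z"
      "Real C Z A \<delta> = seq_equiv C A Z `` {(x0, B0, y0)}"
    using Real_class[OF d(1,3,6)] by (auto simp: quotient_def)
  have B0: "arr x0 A B0" "arr y0 B0 Z" "B0 \<in> Ob C" using s d by (auto simp: sequences_def arr_def)
  obtain b0 where b0: "is_iso C B0 B b0" "b0 \<bullet> x0 = x" "y \<bullet> b0 = y0"
    using d(7) s by (auto simp: seq_equiv_def)
  have ab: "arr b B B'" "arr b0 B0 B" using b b0 B0 d by (auto simp: is_iso_def arr_def)
  have "is_iso C B0 B' (b \<bullet> b0)" using is_iso_Cmp[OF b0(1) b(1) B0(3) d(2) b(2)] .
  moreover have "(b \<bullet> b0) \<bullet> x0 = x'" using arr_Cmp_assoc[OF ab B0(1)] b0 x' by simp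
  moreover have "y' \<bullet> (b \<bullet> b0) = y0" using arr_Cmp_assoc[OF y'(2) ab] b0 y' by simp
  moreover have "(x', B', y') \<in> sequences C A Z"
    using arr_Cmp[OF ab(1) d(4)] x' y' by (auto simp: sequences_def arr_def)
  ultimately have "(x', B', y') \<in> Real C Z A \<delta>" using s by (auto simp: seq_equiv_def)
  then show ?thesis using etriangleI d by blast
qed

lemma iso_to_zero_etriangle:
  assumes "is_iso C A B f" "A \<in> Ob C" "B \<in> Ob C" "is_zero C Z"
  shows "etriangle C A f B \<zero>\<^bsub>Hom C B Z\<^esub> Z \<zero>\<^bsub>Ext C Z A\<^esub>"
proof -
  obtain g where g: "arr g B A" "g \<bullet> f = Idn C A" "f \<bullet> g = Idn C B"
    using is_isoE assms by metis
  have Z: "Z \<in> Ob C" using assms by (simp add: is_zero_iff)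
  show ?thesis
    using Real_zero[OF assms(2) Z is_biproduct_iso_zero[OF assms(1,2,4,3) g]] assms Z Ext_zero_closed
    by (intro etriangleI) auto
qed

lemma zero_to_iso_etriangle:
  assumes "is_iso C B A f" "A \<in> Ob C" "B \<in> Ob C" "is_zero C Z"
  shows "etriangle C Z \<zero>\<^bsub>Hom C Z B\<^esub> B f A \<zero>\<^bsub>Ext C A Z\<^esub>"
proof -
  obtain g where g: "is_iso C A B g" "arr f B A" "f \<bullet> g = Idn C A" "g \<bullet> f = Idn C B"
    using is_isoE[OF assms(1,3,2)] by metis
  have Z: "Z \<in> Ob C" using assms by (simp add: is_zero_iff)
  show ?thesis
    using Real_zero[OF Z assms(2) is_biproduct_commute[OF is_biproduct_iso_zero[OF g(1) assms(2,4,3) g(2,3,4)] assms(2) Z]]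
      assms Z Ext_zero_closed
    by (intro etriangleI) auto
qed

lemma zero_objectE: obtains O' where "is_zero C O'" "O' \<in> Ob C"
  using zero_object by (auto simp: is_zero_iff)

text \<open>
  The proofs from here to \<open>push_inflation\<close> follow one pattern: the given \<open>\<E>\<close>-triangle is compared
  with one of the trivial triangles \<open>W \<rightarrow> W \<rightarrow> 0\<close> and \<open>0 \<rightarrow> W \<rightarrow> W\<close>, and the remaining component of the
  comparison is the wanted morphism or extension.
\<close>

lemma etriangle_Cmp_zero:
  assumes t: "etriangle C A x B y Z \<delta>"
  shows "y \<bullet> x = \<zero>\<^bsub>Hom C A Z\<^esub>"
proof -
  note d = etriangleD[OF t]
  obtain O' where o: "is_zero C O'" "O' \<in> Ob C" by (rule zero_objectE)
  note s = etriangleD[OF iso_to_zero_etriangle[OF is_iso_Idn[OF d(1)] d(1,1) o(1)]]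
  obtain c where c: "arr c O' Z" "c \<bullet> \<zero>\<^bsub>Hom C A O'\<^esub> = y \<bullet> x"
    using ET3[OF s(1,3) d(1,3) s(6) d(6) s(7) d(7), of "Idn C A" x] d(4) arr_Idn[OF d(1)] o(2) d(3)
    by (auto simp: arr_def)
  then show ?thesis using Cmp_zero[OF c(1) d(1)] by simp
qed

lemma weak_cokernel:
  assumes t: "etriangle C A x B y Z \<delta>" and w: "arr w B W" "w \<bullet> x = \<zero>\<^bsub>Hom C A W\<^esub>"
  obtains v where "arr v Z W" "v \<bullet> y = w"
proof -
  note d = etriangleD[OF t]
  have W: "W \<in> Ob C" using w by (simp add: arr_def)
  obtain O' where o: "is_zero C O'" "O' \<in> Ob C" by (rule zero_objectE)
  note s = etriangleD[OF zero_to_iso_etriangle[OF is_iso_Idn[OF W] W W o(1)]]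
  have "w \<bullet> x = \<zero>\<^bsub>Hom C O' W\<^esub> \<bullet> \<zero>\<^bsub>Hom C A O'\<^esub>"
    using w zero_Cmp[OF arr_zero[OF d(1) o(2)] W] by simp
  then obtain c where c: "arr c Z W" "c \<bullet> y = Idn C W \<bullet> w"
    using ET3[OF d(1,3) s(1,3) d(6) s(6) d(7) s(7), of "\<zero>\<^bsub>Hom C A O'\<^esub>" w] w
      arr_zero[OF d(1) o(2)] d(3) W
    by (auto simp: arr_def)
  then show thesis using that arr_Idn_left[OF w(1)] by simp
qed

lemma weak_kernel:
  assumes t: "etriangle C A x B y Z \<delta>" and w: "arr w W B" "y \<bullet> w = \<zero>\<^bsub>Hom C W Z\<^esub>"
  obtains v where "arr v W A" "x \<bullet> v = w"
proof -
  note d = etriangleD[OF t]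
  have W: "W \<in> Ob C" using w by (simp add: arr_def)
  obtain O' where o: "is_zero C O'" "O' \<in> Ob C" by (rule zero_objectE)
  note s = etriangleD[OF iso_to_zero_etriangle[OF is_iso_Idn[OF W] W W o(1)]]
  have "\<zero>\<^bsub>Hom C O' Z\<^esub> \<bullet> \<zero>\<^bsub>Hom C W O'\<^esub> = y \<bullet> w"
    using w zero_Cmp[OF arr_zero[OF W o(2)] d(3)] by simp
  then obtain a where a: "arr a W A" "w \<bullet> Idn C W = x \<bullet> a"
    using ET3_op[OF s(1,3) d(1,3) s(6) d(6) s(7) d(7), of w "\<zero>\<^bsub>Hom C O' Z\<^esub>"] w
      arr_zero[OF o(2) d(3)] d(1) W
    by (auto simp: arr_def)
  then show thesis using that arr_Idn_right[OF w(1)] by simp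
qed

lemma extend_along_inflation:
  assumes t: "etriangle C A x B y Z \<delta>" and w: "arr w A W" "push C w \<delta> = \<zero>\<^bsub>Ext C Z W\<^esub>"
  obtains v where "arr v B W" "v \<bullet> x = w"
proof -
  note d = etriangleD[OF t]
  have W: "W \<in> Ob C" using w by (simp add: arr_def)
  obtain O' where o: "is_zero C O'" "O' \<in> Ob C" by (rule zero_objectE)
  note s = etriangleD[OF iso_to_zero_etriangle[OF is_iso_Idn[OF W] W W o(1)]]
  have "push C w \<delta> = pull C \<zero>\<^bsub>Hom C Z O'\<^esub> \<zero>\<^bsub>Ext C O' W\<^esub>"
    using w pull_Ext_zero[OF arr_zero[OF d(3) o(2)] W] by simp
  then obtain b where b: "arr b B W" "b \<bullet> x = Idn C W \<bullet> w"
    using Real_morphism[OF d(1,3) s(1,3) d(6) s(6) _ _ _ d(7) s(7), of w "\<zero>\<^bsub>Hom C Z O'\<^esub>"] w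
      arr_zero[OF d(3) o(2)] d(2) W
    by (auto simp: arr_def)
  then show thesis using that arr_Idn_left[OF w(1)] by simp
qed

lemma split_deflation:
  assumes t: "etriangle C A x B y Z \<zero>\<^bsub>Ext C Z A\<^esub>"
  obtains s where "arr s Z B" "y \<bullet> s = Idn C Z"
proof -
  note d = etriangleD[OF t]
  obtain O' where o: "is_zero C O'" "O' \<in> Ob C" by (rule zero_objectE)
  note s = etriangleD[OF zero_to_iso_etriangle[OF is_iso_Idn[OF d(3)] d(3,3) o(1)]]
  have "push C \<zero>\<^bsub>Hom C O' A\<^esub> \<zero>\<^bsub>Ext C Z O'\<^esub> = pull C (Idn C Z) \<zero>\<^bsub>Ext C Z A\<^esub>"
    using push_Ext_zero[OF arr_zero[OF o(2) d(1)] d(3)] pull_Idn[OF d(1,3,6)] by simp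
  then obtain b where "arr b Z B" "Idn C Z \<bullet> Idn C Z = y \<bullet> b"
    using Real_morphism[OF s(1,3) d(1,3) s(6) d(6) _ _ _ s(7) d(7), of "\<zero>\<^bsub>Hom C O' A\<^esub>" "Idn C Z"]
      arr_zero[OF o(2) d(1)] arr_Idn[OF d(3)] d(2,3)
    by (auto simp: arr_def)
  then show thesis using that arr_Idn_left[OF arr_Idn[OF d(3)]] by simp
qed

lemma push_inflation:
  assumes t: "etriangle C A x B y Z \<delta>"
  shows "push C x \<delta> = \<zero>\<^bsub>Ext C Z B\<^esub>"
proof -
  note d = etriangleD[OF t]
  obtain O' where o: "is_zero C O'" "O' \<in> Ob C" by (rule zero_objectE)
  note s = etriangleD[OF iso_to_zero_etriangle[OF is_iso_Idn[OF d(2)] d(2,2) o(1)]]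
  obtain c where "arr c Z O'" "push C x \<delta> = pull C c \<zero>\<^bsub>Ext C O' B\<^esub>"
    using ET3[OF d(1,3) s(1,3) d(6) s(6) d(7) s(7), of x "Idn C B"] d(3,4) arr_Idn[OF d(2)] o(2)
    by (auto simp: arr_def)
  then show ?thesis using pull_Ext_zero d(2) by simp
qed

text \<open>
  The deviation \<open>n\<close> of \<open>a\<close> from the identity satisfies \<open>n\<^sub>* \<delta> = 0\<close> and therefore factors through \<open>x\<close>,
  while \<open>x n = 0\<close>; hence \<open>n\<^sup>2 = 0\<close>.
\<close>

lemma etriangle_endo_left:
  assumes t: "etriangle C A x B y Z \<delta>" and a: "arr a A A" "x \<bullet> a = x" "push C a \<delta> = \<delta>"
  shows "is_iso C A A a"
proof -
  note d = etriangleD[OF t]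
  note id = arr_Idn[OF d(1)]
  define n where "n = a \<ominus>\<^bsub>Hom C A A\<^esub> Idn C A"
  have n: "arr n A A" unfolding n_def by (rule arr_diff[OF a(1) id])
  have "push C n \<delta> = \<zero>\<^bsub>Ext C Z A\<^esub>"
    unfolding n_def using push_diff_eq_zero[OF a(1) id d(3,6)] a(3) push_Idn[OF d(1,3,6)] by simp
  then obtain v where v: "arr v B A" "v \<bullet> x = n" using extend_along_inflation[OF t n] by blast
  have "x \<bullet> n = \<zero>\<^bsub>Hom C A B\<^esub>"
    unfolding n_def using Cmp_diff[OF d(4) a(1) id] arr_Idn_right[OF d(4)] a(2)
      arr_diff_eq_zero_iff[OF d(4,4)] by simp
  then have "n \<bullet> n = \<zero>\<^bsub>Hom C A A\<^esub>"
    using arr_Cmp_assoc[OF v(1) d(4) n] v Cmp_zero[OF v(1) d(1)] by simp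
  then show ?thesis using is_iso_if_square_zero_deviation[OF a(1) n_def] by blast
qed

text \<open>
  Here the deviation \<open>n\<close> of \<open>b\<close> from the identity factors through \<open>y\<close> because \<open>n x = 0\<close>, and
  \<open>y n = 0\<close>; again \<open>n\<^sup>2 = 0\<close>.
\<close>

lemma etriangle_endo_mid:
  assumes t: "etriangle C A x B y Z \<delta>" and b: "arr b B B" "b \<bullet> x = x" "y \<bullet> b = y"
  shows "is_iso C B B b"
proof -
  note d = etriangleD[OF t]
  note id = arr_Idn[OF d(2)]
  define n where "n = b \<ominus>\<^bsub>Hom C B B\<^esub> Idn C B"
  have n: "arr n B B" unfolding n_def by (rule arr_diff[OF b(1) id])
  have "n \<bullet> x = \<zero>\<^bsub>Hom C A B\<^esub>"
    unfolding n_def using diff_Cmp[OF b(1) id d(4)] arr_Idn_left[OF d(4)] b(2)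
      arr_diff_eq_zero_iff[OF d(4,4)] by simp
  then obtain v where v: "arr v Z B" "v \<bullet> y = n" using weak_cokernel[OF t n] by blast
  have "y \<bullet> n = \<zero>\<^bsub>Hom C B Z\<^esub>"
    unfolding n_def using Cmp_diff[OF d(5) b(1) id] arr_Idn_right[OF d(5)] b(3)
      arr_diff_eq_zero_iff[OF d(5,5)] by simp
  then have "n \<bullet> n = \<zero>\<^bsub>Hom C B B\<^esub>"
    using arr_Cmp_assoc[OF v(1) d(5) n] v Cmp_zero[OF v(1) d(2)] by simp
  then show ?thesis using is_iso_if_square_zero_deviation[OF b(1) n_def] by blast
qed

text \<open>
  The inverses of \<open>a\<close> and \<open>c\<close> form a morphism of extensions as well, and a realization \<open>b'\<close> of it makes
  \<open>b' b\<close> and \<open>b b'\<close> endomorphisms of \<open>\<E>\<close>-triangles that are the identity on the outer terms.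
\<close>

lemma etriangle_five:
  assumes t: "etriangle C A x B y Z \<delta>" and t': "etriangle C A' x' B' y' Z' \<delta>'"
    and a: "is_iso C A A' a" and c: "is_iso C Z Z' c" and ac: "push C a \<delta> = pull C c \<delta>'"
    and b: "arr b B B'" "b \<bullet> x = x' \<bullet> a" "c \<bullet> y = y' \<bullet> b"
  shows "is_iso C B B' b"
proof -
  note d = etriangleD[OF t] and d' = etriangleD[OF t']
  obtain a' where a': "arr a A A'" "arr a' A' A" "a' \<bullet> a = Idn C A" "a \<bullet> a' = Idn C A'"
    using is_isoE[OF a d(1) d'(1)] by metis
  obtain c' where c': "arr c Z Z'" "arr c' Z' Z" "c' \<bullet> c = Idn C Z" "c \<bullet> c' = Idn C Z'"
    using is_isoE[OF c d(3) d'(3)] by metis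
  have m: "a \<in> Mor C A A'" "a' \<in> Mor C A' A" "c \<in> Mor C Z Z'" "c' \<in> Mor C Z' Z"
    using a' c' by (auto simp: arr_def)
  have "push C a' \<delta>' = push C a' (pull C c' (pull C c \<delta>'))"
    using pull_Cmp[OF d'(1,3) d(3) d'(3) m(3,4) d'(6)] c' pull_Idn[OF d'(1,3,6)] by simp
  also have "\<dots> = pull C c' (push C a' (push C a \<delta>))"
    using push_pull[OF d'(1) d(1) d(3) d'(3) m(2,4) push_closed[OF a'(1) d(3,6)]] ac by simp
  also have "\<dots> = pull C c' \<delta>"
    using push_Cmp[OF d(1) d'(1) d(1) d(3) m(1,2) d(6)] a' push_Idn[OF d(1,3,6)] by simp
  finally obtain b' where b': "arr b' B' B" "b' \<bullet> x' = x \<bullet> a'" "c' \<bullet> y' = y \<bullet> b'"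
    using Real_morphism[OF d'(1,3) d(1,3) d'(6) d(6) m(2,4) _ d'(7) d(7)] d(2) d'(2)
    by (auto simp: arr_def)
  have "is_iso C B B (b' \<bullet> b)"
    using etriangle_endo_mid[OF t arr_Cmp[OF b'(1) b(1)]]
      round_trip_left[OF d(4) d'(4) a'(1,2) b(1) b'(1) b(2) b'(2) a'(3)]
      round_trip_right[OF d(5) d'(5) c'(1,2) b(1) b'(1) b(3) b'(3) c'(3)] by blast
  moreover have "is_iso C B' B' (b \<bullet> b')"
    using etriangle_endo_mid[OF t' arr_Cmp[OF b(1) b'(1)]]
      round_trip_left[OF d'(4) d(4) a'(2,1) b'(1) b(1) b'(2) b(2) a'(4)]
      round_trip_right[OF d'(5) d(5) c'(2,1) b'(1) b(1) b'(3) b(3) c'(4)] by blast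
  ultimately show ?thesis by (rule is_iso_if_both_composites_iso[OF b(1) b'(1)])
qed

text \<open>
  The triangle is compared with \<open>A \<rightarrow> A \<rightarrow> Z\<close>, whose third term may be taken to be the same zero
  object, so that the comparison is an isomorphism at both ends.
\<close>

lemma iso_if_zero_cone:
  assumes "conflation C A x B y Z" "is_zero C Z"
  shows "is_iso C A B x"
proof -
  obtain \<delta> where t: "etriangle C A x B y Z \<delta>" using assms by (auto simp: conflation_def)
  note d = etriangleD[OF t]
  note id = is_iso_Idn[OF d(1)] arr_Idn[OF d(1)]
  note t0 = iso_to_zero_etriangle[OF id(1) d(1,1) assms(2)]
  note d0 = etriangleD[OF t0]
  obtain c where c: "arr c Z Z" "push C (Idn C A) \<zero>\<^bsub>Ext C Z A\<^esub> = pull C c \<delta>"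
      "c \<bullet> \<zero>\<^bsub>Hom C A Z\<^esub> = y \<bullet> x"
    using ET3[OF d0(1,3) d(1,3) d0(6) d(6) d0(7) d(7), of "Idn C A" x] id d by (auto simp: arr_def)
  have "c = Idn C Z" using arr_to_zero[OF assms(2) c(1)] assms(2) by (simp add: is_zero_iff)
  then have "is_iso C Z Z c" using is_iso_Idn d by simp
  then show ?thesis using etriangle_five[OF t0 t id(1) _ c(2) d(4) _ c(3)] by blast
qed

lemma iso_if_zero_cocone:
  assumes "conflation C A x B y Z" "is_zero C A"
  shows "is_iso C B Z y"
proof -
  obtain \<delta> where t: "etriangle C A x B y Z \<delta>" using assms by (auto simp: conflation_def)
  note d = etriangleD[OF t]
  note id = is_iso_Idn[OF d(3)] arr_Idn[OF d(3)]
  note t0 = zero_to_iso_etriangle[OF id(1) d(3,3) assms(2)]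
  note d0 = etriangleD[OF t0]
  obtain a where a: "arr a A A" "push C a \<delta> = pull C (Idn C Z) \<zero>\<^bsub>Ext C Z A\<^esub>"
      "y \<bullet> x = \<zero>\<^bsub>Hom C A Z\<^esub> \<bullet> a"
    using ET3_op[OF d(1,3) d0(1,3) d(6) d0(6) d(7) d0(7), of y "Idn C Z"] id d by (auto simp: arr_def)
  have "a = Idn C A" using arr_to_zero[OF assms(2) a(1)] assms(2) by (simp add: is_zero_iff)
  then have "is_iso C A A a" using is_iso_Idn d by simp
  then show ?thesis using etriangle_five[OF t t0 _ id(1) a(2) d(5) a(3)] by blast
qed

lemma conflation_iso_mid:
  assumes "conflation C A x B y Z" "is_iso C B B' b" "B' \<in> Ob C"
  obtains x' y' where "conflation C A x' B' y' Z"
proof -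
  obtain \<delta> where t: "etriangle C A x B y Z \<delta>" using assms by (auto simp: conflation_def)
  note d = etriangleD[OF t]
  obtain g where g: "arr b B B'" "arr g B' B" "g \<bullet> b = Idn C B"
    using is_isoE[OF assms(2) d(2) assms(3)] by metis
  have "(y \<bullet> g) \<bullet> b = y" using arr_Cmp_assoc[OF d(5) g(2,1)] g arr_Idn_right[OF d(5)] by simp
  then show thesis
    using etriangle_iso_mid[OF t assms(2,3) refl _ arr_Cmp[OF d(5) g(2)]] that
    by (auto simp: conflation_def)
qed

text \<open>
  The pullback of the extension along the inverse of \<open>g\<close> is realized by some sequence, which the
  five-lemma identifies with the required one.
\<close>

lemma conflation_iso_right:
  assumes "conflation C A x B y Z" "is_iso C Z T g" "T \<in> Ob C"
  shows "conflation C A x B (g \<bullet> y) T"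
proof -
  obtain \<delta> where t: "etriangle C A x B y Z \<delta>" using assms by (auto simp: conflation_def)
  note d = etriangleD[OF t]
  obtain g' where g: "arr g Z T" "arr g' T Z" "g' \<bullet> g = Idn C Z"
    using is_isoE[OF assms(2) d(3) assms(3)] by metis
  note \<delta>' = pull_closed[OF g(2) d(1,6)]
  obtain x' B' y' where t': "etriangle C A x' B' y' T (pull C g' \<delta>)"
    using realization_exists[OF d(1) assms(3) \<delta>'] by blast
  note d' = etriangleD[OF t']
  have e: "push C (Idn C A) \<delta> = pull C g (pull C g' \<delta>)"
    using pull_Cmp[OF d(1,3) assms(3) d(3) _ _ d(6), of g' g] g push_Idn[OF d(1,3,6)]
      pull_Idn[OF d(1,3,6)] by (simp add: arr_def)
  obtain b where b: "arr b B B'" "b \<bullet> x = x' \<bullet> Idn C A" "g \<bullet> y = y' \<bullet> b"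
    using Real_morphism[OF d(1,3) d'(1,3) d(6) d'(6) _ _ e d(7) d'(7)] g arr_Idn[OF d(1)] d d'
    by (auto simp: arr_def)
  have bi: "is_iso C B B' b"
    using etriangle_five[OF t t' is_iso_Idn[OF d(1)] assms(2) e b] .
  obtain b' where b': "arr b' B' B" "b' \<bullet> b = Idn C B" "b \<bullet> b' = Idn C B'" "is_iso C B' B b'"
    using is_isoE[OF bi d(2) d'(2)] by metis
  have "b' \<bullet> x' = x"
    using arr_Cmp_assoc[OF b'(1) b(1) d(4)] b(2) b'(2) arr_Idn_right[OF d'(4)] arr_Idn_left[OF d(4)]
    by simp
  moreover have "(g \<bullet> y) \<bullet> b' = y'"
    unfolding b(3) using arr_Cmp_assoc[OF d'(5) b(1) b'(1)] b' arr_Idn_right[OF d'(5)] by simp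
  ultimately show ?thesis
    using etriangle_iso_mid[OF t' b'(4) d(2) _ _ arr_Cmp[OF g(1) d(5)]] by (auto simp: conflation_def)
qed

lemma conflation_Idn_zero: "\<lbrakk>A \<in> Ob C; is_zero C Z\<rbrakk> \<Longrightarrow> conflation C A (Idn C A) A \<zero>\<^bsub>Hom C A Z\<^esub> Z"
  using iso_to_zero_etriangle[OF is_iso_Idn] by (auto simp: conflation_def)

lemma conflation_zero_Idn: "\<lbrakk>A \<in> Ob C; is_zero C Z\<rbrakk> \<Longrightarrow> conflation C Z \<zero>\<^bsub>Hom C Z A\<^esub> A (Idn C A) A"
  using zero_to_iso_etriangle[OF is_iso_Idn] by (auto simp: conflation_def)

text \<open>
  A retraction of \<open>d\<close> makes \<open>E\<close> a biproduct of \<open>D\<close> and \<open>F\<close>. The point is that the given retraction \<open>f\<close>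
  itself, and not just some retraction, becomes the deflation of the complementary conflation.
\<close>

lemma split_conflation_swap:
  assumes "conflation C D d E e F" and f: "arr f E D" "f \<bullet> d = Idn C D"
  obtains s where "conflation C F s E f D"
proof -
  obtain \<delta> where t: "etriangle C D d E e F \<delta>" using assms by (auto simp: conflation_def)
  note D = etriangleD[OF t]
  have "\<delta> = push C f (push C d \<delta>)"
    using push_Cmp[OF D(1,2,1,3) _ _ D(6), of d f] D(4) f push_Idn[OF D(1,3,6)]
    by (simp add: arr_def)
  also have "\<dots> = \<zero>\<^bsub>Ext C F D\<^esub>" using push_inflation[OF t] push_Ext_zero[OF f(1) D(3)] by simp
  finally obtain s0 where s0: "arr s0 F E" "e \<bullet> s0 = Idn C F" using split_deflation t by blast
  note df = arr_Cmp[OF D(4) f(1)]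
  note dfs = arr_Cmp[OF df s0(1)]
  \<comment> \<open>the section of \<open>e\<close> is corrected to be killed by \<open>f\<close>\<close>
  define s where "s = s0 \<ominus>\<^bsub>Hom C F E\<^esub> (d \<bullet> f) \<bullet> s0"
  have s: "arr s F E" unfolding s_def by (rule arr_diff[OF s0(1) dfs])
  have fdf: "f \<bullet> (d \<bullet> f) = f" using arr_Cmp_assoc[OF f(1) D(4) f(1)] f arr_Idn_left[OF f(1)] by simp
  have edf: "e \<bullet> (d \<bullet> f) = \<zero>\<^bsub>Hom C E F\<^esub>"
    using arr_Cmp_assoc[OF D(5,4) f(1)] etriangle_Cmp_zero[OF t] zero_Cmp[OF f(1) D(3)] by simp
  have fs: "f \<bullet> s = \<zero>\<^bsub>Hom C F D\<^esub>"
    unfolding s_def using Cmp_diff[OF f(1) s0(1) dfs] arr_Cmp_assoc[OF f(1) df s0(1)] fdf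
      arr_diff_eq_zero_iff[OF arr_Cmp[OF f(1) s0(1)] arr_Cmp[OF f(1) s0(1)]] by simp
  have es: "e \<bullet> s = Idn C F"
    unfolding s_def using Cmp_diff[OF D(5) s0(1) dfs] arr_Cmp_assoc[OF D(5) df s0(1)] edf
      zero_Cmp[OF s0(1) D(3)] s0(2) arr_diff_zero[OF arr_Idn[OF D(3)]] by simp
  note id = arr_Idn[OF D(2)]
  note se = arr_Cmp[OF s D(5)]
  \<comment> \<open>the deviation \<open>n\<close> of \<open>d f + s e\<close> from the identity factors through \<open>d\<close> and is killed by \<open>f\<close>, so it vanishes\<close>
  define k where "k = Idn C E \<ominus>\<^bsub>Hom C E E\<^esub> s \<bullet> e"
  define n where "n = k \<ominus>\<^bsub>Hom C E E\<^esub> d \<bullet> f"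
  have k: "arr k E E" unfolding k_def by (rule arr_diff[OF id se])
  have n: "arr n E E" unfolding n_def by (rule arr_diff[OF k df])
  have ek: "e \<bullet> k = \<zero>\<^bsub>Hom C E F\<^esub>"
    unfolding k_def using Cmp_diff[OF D(5) id se] arr_Cmp_assoc[OF D(5) s D(5)] es
      arr_Idn_left[OF D(5)] arr_Idn_right[OF D(5)] arr_diff_eq_zero_iff[OF D(5,5)] by simp
  have fk: "f \<bullet> k = f"
    unfolding k_def using Cmp_diff[OF f(1) id se] arr_Cmp_assoc[OF f(1) s D(5)] fs
      zero_Cmp[OF D(5,1)] arr_Idn_right[OF f(1)] arr_diff_zero[OF f(1)] by simp
  have "e \<bullet> n = \<zero>\<^bsub>Hom C E F\<^esub>"
    unfolding n_def using Cmp_diff[OF D(5) k df] ek edf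
      arr_diff_eq_zero_iff[OF arr_zero arr_zero, OF D(2,3,2,3)] by simp
  then obtain w where w: "arr w E D" "d \<bullet> w = n" using weak_kernel[OF t n] by blast
  have "f \<bullet> n = \<zero>\<^bsub>Hom C E D\<^esub>"
    unfolding n_def using Cmp_diff[OF f(1) k df] fk fdf arr_diff_eq_zero_iff[OF f(1,1)] by simp
  then have "w = \<zero>\<^bsub>Hom C E D\<^esub>"
    using arr_Cmp_assoc[OF f(1) D(4) w(1)] w(2) f(2) arr_Idn_left[OF w(1)] by simp
  then have "n = \<zero>\<^bsub>Hom C E E\<^esub>" using w Cmp_zero[OF D(4,2)] by simp
  then have "k = d \<bullet> f" using arr_diff_eq_zero_iff[OF k df] by (simp add: n_def)
  then have "d \<bullet> f \<oplus>\<^bsub>Hom C E E\<^esub> s \<bullet> e = Idn C E" using arr_diff_add[OF id se] by (simp add: k_def)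
  then have "is_biproduct C D F E d s f e"
    using D f s fs es etriangle_Cmp_zero[OF t] by (auto simp: is_biproduct_def arr_def)
  then have "(s, E, f) \<in> Real C D F \<zero>\<^bsub>Ext C D F\<^esub>"
    using Real_zero[OF D(3,1)] is_biproduct_commute[OF _ D(1,3)] by blast
  then have "conflation C F s E f D"
    using etriangleI[OF D(3,1) Ext_zero_closed[OF D(1,3)]] by (auto simp: conflation_def)
  then show thesis using that by blast
qed

lemma conflation_ET4:
  assumes "conflation C A f B f' D" "conflation C B g G g' F"
  obtains E h' d e where "conflation C A (g \<bullet> f) G h' E" "conflation C D d E e F"
    "h' \<bullet> g = d \<bullet> f'" "e \<bullet> h' = g'"
proof -
  obtain \<delta> \<delta>' where t: "etriangle C A f B f' D \<delta>" "etriangle C B g G g' F \<delta>'"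
    using assms by (auto simp: conflation_def)
  note d = etriangleD[OF t(1)] and d' = etriangleD[OF t(2)]
  obtain E h' u v \<delta>'' where E: "E \<in> Ob C" "\<delta>'' \<in> EE C E A" "h' \<bullet> g = u \<bullet> f'" "v \<bullet> h' = g'"
      "(g \<bullet> f, G, h') \<in> Real C E A \<delta>''" "(u, E, v) \<in> Real C F D (push C f' \<delta>')"
    using ET4[OF d(1,2,3) d'(3) d(6) d'(6) d(7) d'(7)] by metis
  have "conflation C A (g \<bullet> f) G h' E" "conflation C D u E v F"
    using etriangleI[OF d(1) E(1,2,5)] etriangleI[OF d(3) d'(3) push_closed[OF d(5) d'(3,6)] E(6)]
    by (auto simp: conflation_def)
  then show thesis using that E by blast
qed

lemma conflation_ET4_op:
  assumes "conflation C D f' A f B" "conflation C F g' B g Z"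
  obtains E h' d e where "conflation C E h' A (g \<bullet> f) Z" "conflation C D d E e F"
    "f \<bullet> h' = g' \<bullet> e" "h' \<bullet> d = f'"
proof -
  obtain \<delta> \<delta>' where t: "etriangle C D f' A f B \<delta>" "etriangle C F g' B g Z \<delta>'"
    using assms by (auto simp: conflation_def)
  note d = etriangleD[OF t(1)] and d' = etriangleD[OF t(2)]
  obtain E h' u v \<delta>'' where E: "E \<in> Ob C" "\<delta>'' \<in> EE C Z E" "f \<bullet> h' = g' \<bullet> v" "h' \<bullet> u = f'"
      "(h', A, g \<bullet> f) \<in> Real C Z E \<delta>''" "(u, E, v) \<in> Real C F D (pull C g' \<delta>)"
    using ET4_op[OF d(1,3) d'(1,3) d(6) d'(6) d(7) d'(7)] by metis
  have "conflation C E h' A (g \<bullet> f) Z" "conflation C D u E v F"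
    using etriangleI[OF E(1) d'(3) E(2,5)] etriangleI[OF d(1) d'(1) pull_closed[OF d'(4) d(1,6)] E(6)]
    by (auto simp: conflation_def)
  then show thesis using that E by blast
qed

end

section \<open>Filtrations and their length\<close>

text \<open>
  Counting the factors of a filtration makes length available as an induction measure. An object may
  a priori lie in several layers.
\<close>

primrec Filt_layer :: "('o, 'm, 'e, 'k, 'z) extcat_scheme \<Rightarrow> 'o set \<Rightarrow> nat \<Rightarrow> 'o set" where
  "Filt_layer C \<X> 0 = {Z. is_zero C Z}"
| "Filt_layer C \<X> (Suc n) = star C (Filt_layer C \<X> n) \<X>"

lemma Filt_eq_layers: "Filt C \<X> = (\<Union>n. Filt_layer C \<X> n)"
proof (intro equalityI subsetI)
  fix M assume "M \<in> Filt C \<X>"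
  then obtain n Y f where M: "is_zero C (Y 0)" "Y n = M"
      "\<And>i. i < n \<Longrightarrow> \<exists>y. \<exists>Z \<in> \<X>. conflation C (Y i) (f i) (Y (Suc i)) y Z"
    by (auto simp: Filt_def)
  have "i \<le> n \<Longrightarrow> Y i \<in> Filt_layer C \<X> i" for i
  proof (induction i)
    case (Suc i)
    then show ?case using M(3)[of i] by (fastforce simp: star_def)
  qed (use M in simp)
  then show "M \<in> (\<Union>n. Filt_layer C \<X> n)" using M by blast
next
  fix M assume "M \<in> (\<Union>n. Filt_layer C \<X> n)"
  then obtain n where "M \<in> Filt_layer C \<X> n" by blast
  then have "\<exists>Y f. is_zero C (Y 0) \<and> Y n = M \<and>
     (\<forall>i<n. \<exists>y. \<exists>Z \<in> \<X>. conflation C (Y i) (f i) (Y (Suc i)) y Z)"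
  proof (induction n arbitrary: M)
    case 0
    then show ?case by (intro exI[of _ "\<lambda>_. M"]) simp
  next
    case (Suc n)
    then obtain L Z x y where L: "L \<in> Filt_layer C \<X> n" "Z \<in> \<X>" "conflation C L x M y Z"
      by (auto simp: star_def)
    obtain Y f where "is_zero C (Y 0)" "Y n = L"
        "\<forall>i<n. \<exists>y. \<exists>Z \<in> \<X>. conflation C (Y i) (f i) (Y (Suc i)) y Z"
      using Suc.IH[OF L(1)] by blast
    then show ?case
      using L by (intro exI[of _ "Y(Suc n := M)"] exI[of _ "f(n := x)"]) (auto simp: less_Suc_eq)
  qed
  then show "M \<in> Filt C \<X>" by (auto simp: Filt_def)
qed

lemma conflation_full_sub:
  assumes "\<D> \<subseteq> Ob C"
  shows "conflation (full_sub C \<D>) A x B y Z \<longleftrightarrow>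
    A \<in> \<D> \<and> B \<in> \<D> \<and> Z \<in> \<D> \<and> conflation C A x B y Z"
  using assms by (auto simp: conflation_def etriangle_def full_sub_def)

lemma full_sub_simps [simp]:
  "Ob (full_sub C \<D>) = \<D>" "Hom (full_sub C \<D>) = Hom C" "Cmp (full_sub C \<D>) = Cmp C"
  "Idn (full_sub C \<D>) = Idn C"
  by (simp_all add: full_sub_def)

context extriangulated_category
begin

lemma is_zero_full_sub:
  assumes "\<D> \<subseteq> Ob C"
  shows "is_zero (full_sub C \<D>) Z \<longleftrightarrow> Z \<in> \<D> \<and> is_zero C Z"
proof
  assume "is_zero (full_sub C \<D>) Z"
  then have Z: "Z \<in> \<D>" "\<exists>!f. f \<in> Mor C Z Z" by (auto simp: is_zero_def)
  moreover have "Idn C Z = \<zero>\<^bsub>Hom C Z Z\<^esub>"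
    using Z assms arr_Idn[of Z] arr_zero[of Z Z] by (auto simp: arr_def)
  ultimately show "Z \<in> \<D> \<and> is_zero C Z" using assms by (auto simp: is_zero_iff)
next
  assume "Z \<in> \<D> \<and> is_zero C Z"
  then show "is_zero (full_sub C \<D>) Z"
    using assms unfolding is_zero_def full_sub_simps by (meson subsetD)
qed

lemma Filt_layer_subset_Ob: "Filt_layer C \<X> n \<subseteq> Ob C"
  using conflationD by (cases n) (auto simp: is_zero_iff star_def)

lemma Filt_layer_iso:
  assumes "M \<in> Filt_layer C \<X> n" "is_iso C M M' b" "M' \<in> Ob C"
  shows "M' \<in> Filt_layer C \<X> n"
proof (cases n)
  case 0
  then show ?thesis using assms is_zero_iso by auto
next
  case (Suc k)
  then obtain L Z x y where "L \<in> Filt_layer C \<X> k" "Z \<in> \<X>" "conflation C L x M y Z"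
    using assms by (auto simp: star_def)
  then show ?thesis
    unfolding Suc using conflation_iso_mid[OF _ assms(2,3)] by (auto simp: star_def) metis
qed

text \<open>
  A conflation \<open>A \<rightarrow> B \<rightarrow> Z\<close> and the top factor \<open>Z \<rightarrow> S\<close> of a filtration combine to a deflation
  \<open>B \<rightarrow> S\<close>, whose cocone is an extension of a shorter object by \<open>A\<close>.
\<close>

lemma Filt_layer_extension:
  assumes "conflation C A x B y Z" "A \<in> Filt_layer C \<X> a" "Z \<in> Filt_layer C \<X> n"
  shows "B \<in> Filt_layer C \<X> (a + n)"
  using assms
proof (induction n arbitrary: B x y Z)
  case 0
  then show ?case
    using iso_if_zero_cone[OF 0(1)] Filt_layer_iso[OF 0(2)] conflationD[OF 0(1)] by auto
next
  case (Suc n)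
  then obtain L S u v where L: "L \<in> Filt_layer C \<X> n" "S \<in> \<X>" "conflation C L u Z v S"
    by (auto simp: star_def)
  obtain E h d e where E: "conflation C E h B (v \<bullet> y) S" "conflation C A d E e L"
    using conflation_ET4_op[OF Suc.prems(1) L(3)] by metis
  have "E \<in> Filt_layer C \<X> (a + n)" using Suc.IH[OF E(2) Suc.prems(2) L(1)] .
  then show ?case using E L by (auto simp: star_def)
qed

lemma Filt_extension:
  assumes "conflation C A x B y Z" "A \<in> Filt C \<X>" "Z \<in> Filt C \<X>"
  shows "B \<in> Filt C \<X>"
  using assms Filt_layer_extension by (force simp: Filt_eq_layers)

lemma Filt_subset_Ob: "Filt C \<X> \<subseteq> Ob C"
  using Filt_layer_subset_Ob by (fastforce simp: Filt_eq_layers)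

lemma is_zero_in_Filt: "is_zero C Z \<Longrightarrow> Z \<in> Filt C \<X>"
  unfolding Filt_eq_layers by (rule UN_I[of 0]) simp_all

lemma subset_Filt_layer_1:
  assumes "S \<in> \<X>" "\<X> \<subseteq> Ob C"
  shows "S \<in> Filt_layer C \<X> 1"
proof -
  obtain O' where "is_zero C O'" by (rule zero_objectE)
  moreover from this have "conflation C O' \<zero>\<^bsub>Hom C O' S\<^esub> S (Idn C S) S"
    using conflation_zero_Idn assms by blast
  ultimately show ?thesis using assms(1) by (auto simp: star_def)
qed

lemma extension_closed_Filt: "extension_closed C (Filt C \<X>)"
proof -
  have "iso_closed C (Filt C \<X>)"
    using Filt_subset_Ob Filt_layer_iso
    by (auto simp: iso_closed_def isomorphic_def Filt_eq_layers) metis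
  moreover obtain O' where o: "is_zero C O'" by (rule zero_objectE)
  moreover have "star C (Filt C \<X>) (Filt C \<X>) = Filt C \<X>"
  proof (intro equalityI subsetI)
    fix M assume M: "M \<in> Filt C \<X>"
    then have "conflation C O' \<zero>\<^bsub>Hom C O' M\<^esub> M (Idn C M) M"
      using conflation_zero_Idn[OF _ o] Filt_subset_Ob by blast
    then show "M \<in> star C (Filt C \<X>) (Filt C \<X>)"
      using M is_zero_in_Filt[OF o] unfolding star_def by blast
  qed (use Filt_extension in \<open>auto simp: star_def\<close>)
  ultimately show ?thesis using is_zero_in_Filt unfolding extension_closed_def by blast
qed

text \<open>
  If all morphisms from \<open>M\<close> to \<open>\<X>\<close> vanish, then so do all morphisms from \<open>M\<close> to filtered objects, in
  particular the identity of \<open>M\<close>.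
\<close>

lemma nonzero_morphism_to_generator:
  assumes M: "M \<in> Filt_layer C \<X> n" "\<not> is_zero C M"
  obtains T f where "T \<in> \<X>" "arr f M T" "f \<noteq> \<zero>\<^bsub>Hom C M T\<^esub>"
proof (rule ccontr)
  assume "\<not> thesis"
  then have z: "\<And>T f. \<lbrakk>T \<in> \<X>; arr f M T\<rbrakk> \<Longrightarrow> f = \<zero>\<^bsub>Hom C M T\<^esub>" using that by blast
  have "\<lbrakk>N \<in> Filt_layer C \<X> k; arr g M N\<rbrakk> \<Longrightarrow> g = \<zero>\<^bsub>Hom C M N\<^esub>" for N k g
  proof (induction k arbitrary: N g)
    case 0
    then show ?case using arr_to_zero by simp
  next
    case (Suc k)
    then obtain L Z x y where L: "L \<in> Filt_layer C \<X> k" "Z \<in> \<X>" "conflation C L x N y Z"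
      by (auto simp: star_def)
    then obtain \<delta> where t: "etriangle C L x N y Z \<delta>" by (auto simp: conflation_def)
    note d = etriangleD[OF t]
    have "y \<bullet> g = \<zero>\<^bsub>Hom C M Z\<^esub>" using z[OF L(2) arr_Cmp[OF d(5) Suc.prems(2)]] .
    then obtain v where v: "arr v M L" "x \<bullet> v = g" using weak_kernel[OF t Suc.prems(2)] by blast
    then show ?case using Suc.IH[OF L(1) v(1)] Cmp_zero[OF d(4)] by (simp add: arr_def)
  qed
  moreover have "M \<in> Ob C" using M Filt_layer_subset_Ob by blast
  ultimately show False using M arr_Idn by (simp add: is_zero_iff)
qed

end

section \<open>Semibricks\<close>

context extriangulated_category
begin

lemma brick_endomorphism_iso:
  assumes "brick C M" "arr f M M" "f \<noteq> \<zero>\<^bsub>Hom C M M\<^esub>"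
  shows "is_iso C M M f"
proof -
  have "f \<in> Units (End_ring C M)"
    using assms by (auto simp: brick_def division_ring_def End_ring_def arr_def)
  then show ?thesis using assms by (auto simp: Units_def End_ring_def is_iso_def arr_def)
qed

lemma brick_nonzero: "brick C M \<Longrightarrow> \<not> is_zero C M"
  by (auto simp: brick_def division_ring_def End_ring_def is_zero_iff)

lemma semibrick_subset_Ob: "semibrick C \<X> \<Longrightarrow> \<X> \<subseteq> Ob C"
  by (auto simp: semibrick_def iso_closed_def)

text \<open>
  A nonzero Hom-space forces \<open>M\<close> and \<open>N\<close> to be isomorphic, but \<open>g\<close> itself need not be the chosen
  isomorphism; composing with its inverse reduces to a nonzero endomorphism of a brick.
\<close>

lemma semibrick_nonzero_iso:
  assumes X: "semibrick C \<X>" "M \<in> \<X>" "N \<in> \<X>" and g: "arr g M N" "g \<noteq> \<zero>\<^bsub>Hom C M N\<^esub>"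
  shows "is_iso C M N g"
proof -
  have ob: "M \<in> Ob C" "N \<in> Ob C" using g by (auto simp: arr_def)
  have "isomorphic C M N" using X g by (auto simp: semibrick_def arr_def)
  then obtain \<phi> where \<phi>: "is_iso C M N \<phi>" by (auto simp: isomorphic_def)
  then obtain \<psi> where \<psi>: "arr \<phi> M N" "arr \<psi> N M" "\<phi> \<bullet> \<psi> = Idn C N"
    using is_isoE[OF \<phi> ob] by metis
  have e: "\<phi> \<bullet> (\<psi> \<bullet> g) = g"
    using arr_Cmp_assoc[OF \<psi>(1,2) g(1)] \<psi>(3) arr_Idn_left[OF g(1)] by simp
  then have "\<psi> \<bullet> g \<noteq> \<zero>\<^bsub>Hom C M M\<^esub>" using g Cmp_zero[OF \<psi>(1) ob(1)] by metis
  then have "is_iso C M M (\<psi> \<bullet> g)"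
    using brick_endomorphism_iso[OF _ arr_Cmp[OF \<psi>(2) g(1)]] X by (auto simp: semibrick_def)
  then show ?thesis using is_iso_Cmp[OF _ \<phi> ob(1,1,2)] e by metis
qed

text \<open>
  Otherwise \<open>u - 1\<close> would be invertible, and it kills \<open>g\<close>.
\<close>

lemma brick_endomorphism_absorbed:
  assumes T: "brick C T" and u: "arr u T T" and g: "arr g M T" "u \<bullet> g = g" "g \<noteq> \<zero>\<^bsub>Hom C M T\<^esub>"
  shows "u = Idn C T"
proof (rule ccontr)
  have ob: "M \<in> Ob C" "T \<in> Ob C" using g by (auto simp: arr_def)
  note id = arr_Idn[OF ob(2)]
  note n = arr_diff[OF u id]
  assume "u \<noteq> Idn C T"
  then have "is_iso C T T (u \<ominus>\<^bsub>Hom C T T\<^esub> Idn C T)"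
    using brick_endomorphism_iso[OF T n] arr_diff_eq_zero_iff[OF u id] by simp
  then obtain w where w: "arr w T T" "w \<bullet> (u \<ominus>\<^bsub>Hom C T T\<^esub> Idn C T) = Idn C T"
    using is_isoE ob by metis
  have "(u \<ominus>\<^bsub>Hom C T T\<^esub> Idn C T) \<bullet> g = \<zero>\<^bsub>Hom C M T\<^esub>"
    using diff_Cmp[OF u id g(1)] g(2) arr_Idn_left[OF g(1)] arr_diff_eq_zero_iff[OF g(1,1)] by simp
  then have "g = \<zero>\<^bsub>Hom C M T\<^esub>"
    using arr_Cmp_assoc[OF w(1) n g(1)] w(2) arr_Idn_left[OF g(1)] Cmp_zero[OF w(1) ob(1)] by simp
  then show False using g by blast
qed

text \<open>
  Let \<open>L \<rightarrow> M \<rightarrow> Z\<close> be the last step of a filtration. If \<open>f\<close> vanishes on \<open>L\<close>, it is \<open>M \<rightarrow> Z\<close> followed by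
  an isomorphism. Otherwise \<open>L \<rightarrow> T\<close> is a deflation by induction, with cocone \<open>L'\<close>, and \<open>f\<close> factors as
  \<open>M \<rightarrow> E \<rightarrow> T\<close> for \<open>E\<close> the cone of \<open>L' \<rightarrow> M\<close>. As \<open>E\<close> is an extension of \<open>Z\<close> by \<open>T\<close> and \<open>E \<rightarrow> T\<close> splits it,
  both \<open>M \<rightarrow> E\<close> and \<open>E \<rightarrow> T\<close> are deflations, and the cocone of \<open>f\<close> is an extension of \<open>Z\<close> by \<open>L'\<close>.
\<close>

lemma deflation_onto_generator:
  assumes X: "semibrick C \<X>" "T \<in> \<X>"
    and M: "M \<in> Filt_layer C \<X> n" and f: "arr f M T" "f \<noteq> \<zero>\<^bsub>Hom C M T\<^esub>"
  obtains m L x where "n = Suc m" "L \<in> Filt_layer C \<X> m" "conflation C L x M f T"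
proof -
  have brick: "brick C T" using X by (auto simp: semibrick_def)
  have "\<exists>m L x. n = Suc m \<and> L \<in> Filt_layer C \<X> m \<and> conflation C L x M f T"
    using M f
  proof (induction n arbitrary: M f)
    case 0
    then show ?case using arr_from_zero by auto
  next
    case (Suc n)
    have T: "T \<in> Ob C" using Suc.prems by (auto simp: arr_def)
    from Suc.prems obtain L Z i p where
      L: "L \<in> Filt_layer C \<X> n" "Z \<in> \<X>" "conflation C L i M p Z"
      by (auto simp: star_def)
    then obtain \<delta> where t: "etriangle C L i M p Z \<delta>" by (auto simp: conflation_def)
    note d = etriangleD[OF t]
    note fi = arr_Cmp[OF Suc.prems(2) d(4)]
    show ?case
    proof (cases "f \<bullet> i = \<zero>\<^bsub>Hom C L T\<^esub>")
      case True
      then obtain g where g: "arr g Z T" "g \<bullet> p = f" using weak_cokernel[OF t Suc.prems(2)] by blast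
      then have "g \<noteq> \<zero>\<^bsub>Hom C Z T\<^esub>" using Suc.prems(3) zero_Cmp[OF d(5) T] by auto
      then have "is_iso C Z T g" using semibrick_nonzero_iso[OF X(1) L(2) X(2) g(1)] by blast
      then show ?thesis using conflation_iso_right[OF L(3) _ T] g L by auto
    next
      case False
      obtain m L' k where m: "n = Suc m" "L' \<in> Filt_layer C \<X> m" "conflation C L' k L (f \<bullet> i) T"
        using Suc.IH[OF L(1) fi False] by blast
      obtain E h d' e where E: "conflation C L' (i \<bullet> k) M h E" "conflation C T d' E e Z"
          "h \<bullet> i = d' \<bullet> (f \<bullet> i)"
        using conflation_ET4[OF m(3) L(3)] by metis
      note c = conflationD[OF E(1)] and c' = conflationD[OF E(2)] and ck = conflationD[OF m(3)]
      obtain \<delta>k where tk: "etriangle C L' k L (f \<bullet> i) T \<delta>k" using m by (auto simp: conflation_def)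
      have "f \<bullet> (i \<bullet> k) = \<zero>\<^bsub>Hom C L' T\<^esub>"
        using etriangle_Cmp_zero[OF tk] arr_Cmp_assoc[OF Suc.prems(2) d(4) ck(4)] by simp
      then obtain g where g: "arr g E T" "g \<bullet> h = f"
        using E(1) weak_cokernel[OF _ Suc.prems(2)] unfolding conflation_def by metis
      have "(g \<bullet> d') \<bullet> (f \<bullet> i) = f \<bullet> i"
        using arr_Cmp_assoc[OF g(1) c'(4) fi] arr_Cmp_assoc[OF g(1) c(5) d(4)] E(3) g(2) by simp
      then have "g \<bullet> d' = Idn C T"
        using brick_endomorphism_absorbed[OF brick arr_Cmp[OF g(1) c'(4)] fi] False by blast
      then obtain s where s: "conflation C Z s E g T"
        using split_conflation_swap[OF E(2) g(1)] by blast
      obtain E2 x u v where E2: "conflation C E2 x M (g \<bullet> h) T" "conflation C L' u E2 v Z"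
        using conflation_ET4_op[OF E(1) s] by metis
      have "E2 \<in> Filt_layer C \<X> n" unfolding m(1) using E2(2) m(2) L(2) by (auto simp: star_def)
      then show ?thesis using E2(1) g(2) by auto
    qed
  qed
  then show thesis using that by blast
qed

end

section \<open>Length in the filtration category of a simple semibrick\<close>

locale simple_semibrick = extriangulated_category +
  fixes \<X>
  assumes semibrick: "semibrick C \<X>"
    and simple: "simple_set C \<X>"
begin

abbreviation layer where
  "layer \<equiv> Filt_layer C \<X>"

lemma X_subset_Ob: "\<X> \<subseteq> Ob C"
  using semibrick semibrick_subset_Ob by blast

lemma X_layer: "S \<in> \<X> \<Longrightarrow> S \<in> layer 1"
  using subset_Filt_layer_1 X_subset_Ob by blast

lemma layer_Filt: "M \<in> layer n \<Longrightarrow> M \<in> Filt C \<X>"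
  by (auto simp: Filt_eq_layers)

lemma X_Filt: "S \<in> \<X> \<Longrightarrow> S \<in> Filt C \<X>"
  using layer_Filt[OF X_layer] .

text \<open>
  A conflation \<open>K \<rightarrow> M \<rightarrow> Z\<close> with \<open>M = 0\<close> and \<open>Z \<in> \<X>\<close> is added to \<open>Z \<rightarrow> Z \<rightarrow> 0\<close>. The resulting
  conflation \<open>Z \<oplus> K \<rightarrow> Z \<rightarrow> Z\<close> contradicts the simplicity of \<open>Z\<close>.
\<close>

lemma zero_object_length:
  assumes "M \<in> layer n" "is_zero C M"
  shows "n = 0"
proof (cases n)
  case (Suc k)
  then obtain K Z x y where K: "K \<in> layer k" "Z \<in> \<X>" "conflation C K x M y Z"
    using assms by (auto simp: star_def)
  then obtain \<delta> where t: "etriangle C K x M y Z \<delta>" by (auto simp: conflation_def)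
  note d = etriangleD[OF t]
  note id = is_iso_Idn[OF d(3)] arr_Idn[OF d(3)]
  \<comment> \<open>\<open>M\<close> itself serves as the zero object, so \<open>Z\<close> is a biproduct of \<open>Z\<close> and \<open>M\<close>\<close>
  note t0 = iso_to_zero_etriangle[OF id(1) d(3,3) assms(2)]
  note d0 = etriangleD[OF t0]
  note bp = is_biproduct_iso_zero[OF id(1) d(3) assms(2) d(3) id(2)
      arr_Idn_left[OF id(2)] arr_Idn_left[OF id(2)]]
  obtain S i j p q where S: "is_biproduct C Z K S i j p q" using biproducts d by blast
  have ij: "arr i Z S" "arr j K S" "S \<in> Ob C" using S d by (auto simp: is_biproduct_def arr_def)
  note z = arr_zero[OF d(3,2)]
  have "push C i (pull C \<zero>\<^bsub>Hom C Z M\<^esub> \<zero>\<^bsub>Ext C M Z\<^esub>) \<oplus>\<^bsub>Ext C Z S\<^esub> push C j (pull C (Idn C Z) \<delta>) \<in> EE C Z S"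
    using abelian_monoid.a_closed[OF abelian_group.axioms(1)[OF Ext_group[OF d(3) ij(3)]]]
      push_closed[OF ij(1) d(3) pull_closed[OF z d(3) d0(6)]]
      push_closed[OF ij(2) d(3) pull_closed[OF id(2) d(1,6)]] by blast
  then obtain u v where c: "conflation C S u Z v Z"
    using etriangleI[OF ij(3) d(3) _ Real_sum[OF d0(1,3) d(1,3) d0(6) d(6) d0(7) d(7) S bp
          is_biproduct_commute[OF bp d(3,2)]]]
    unfolding conflation_def by blast
  have "conflation C Z i S q K"
    using etriangleI[OF d(3,1) Ext_zero_closed[OF d(1,3)] Real_zero[OF d(3,1) S]]
    by (auto simp: conflation_def)
  then have "S \<in> Filt C \<X>" using Filt_extension[OF _ X_Filt[OF K(2)] layer_Filt[OF K(1)]] by blast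
  moreover have "\<not> is_zero C S"
    using S is_zero_retract[of S i Z p] brick_nonzero[of Z] semibrick K(2) d(3)
    by (auto simp: semibrick_def is_biproduct_def arr_def)
  moreover have "is_simple (full_sub C (Filt C \<X>)) Z"
    using simple K(2) by (auto simp: simple_set_def sim_def)
  ultimately have False
    using c unfolding is_simple_def conflation_full_sub[OF Filt_subset_Ob] is_zero_full_sub[OF Filt_subset_Ob]
    using X_Filt[OF K(2)] brick_nonzero[of Z] semibrick K(2) by (auto simp: semibrick_def)
  then show ?thesis ..
qed

text \<open>
  For a nonzero \<open>f : M \<rightarrow> T\<close> the cocone \<open>K\<close> of \<open>f\<close> is a retract of the cocone \<open>L\<close> of \<open>f r : N \<rightarrow> T\<close>: the
  morphisms \<open>a : K \<rightarrow> L\<close> and \<open>a' : L \<rightarrow> K\<close> induced by \<open>i\<close> and \<open>r\<close> compose to an endomorphism of \<open>K\<close> that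
  preserves both the inflation and the extension, and so is invertible.
\<close>

lemma retract_length_le:
  assumes "M \<in> layer m" "N \<in> layer n" "arr i M N" "arr r N M" "r \<bullet> i = Idn C M"
  shows "m \<le> n"
  using assms
proof (induction m arbitrary: M N n i r)
  case (Suc m)
  note i = Suc.prems(3) and r = Suc.prems(4)
  have ob: "M \<in> Ob C" "N \<in> Ob C" using i by (auto simp: arr_def)
  have "\<not> is_zero C M" using zero_object_length[OF Suc.prems(1)] by auto
  then obtain T f where f: "T \<in> \<X>" "arr f M T" "f \<noteq> \<zero>\<^bsub>Hom C M T\<^esub>"
    using nonzero_morphism_to_generator[OF Suc.prems(1)] by blast
  have T: "T \<in> Ob C" using f by (simp add: arr_def)
  note g = arr_Cmp[OF f(2) r]
  have gi: "(f \<bullet> r) \<bullet> i = f"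
    using arr_Cmp_assoc[OF f(2) r i] Suc.prems(5) arr_Idn_right[OF f(2)] by simp
  then have "f \<bullet> r \<noteq> \<zero>\<^bsub>Hom C N T\<^esub>" using f(3) zero_Cmp[OF i T] by auto
  then obtain n' L y where L: "n = Suc n'" "L \<in> layer n'" "conflation C L y N (f \<bullet> r) T"
    using deflation_onto_generator[OF semibrick f(1) Suc.prems(2) g] by blast
  obtain K x where K: "K \<in> layer m" "conflation C K x M f T"
    using deflation_onto_generator[OF semibrick f(1) Suc.prems(1) f(2,3)] by blast
  obtain \<delta> \<delta>' where t: "etriangle C K x M f T \<delta>" "etriangle C L y N (f \<bullet> r) T \<delta>'"
    using K L by (auto simp: conflation_def)
  note d = etriangleD[OF t(1)] and d' = etriangleD[OF t(2)]
  note id = arr_Idn[OF T]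
  obtain a where a: "arr a K L" "push C a \<delta> = \<delta>'" "i \<bullet> x = y \<bullet> a"
    using ET3_op[OF d(1,3) d'(1,3) d(6) d'(6) d(7) d'(7), of i "Idn C T"] i id gi
      arr_Idn_left[OF f(2)] pull_Idn[OF d'(1,3,6)] d(1) d'(1) by (auto simp: arr_def)
  obtain a' where a': "arr a' L K" "push C a' \<delta>' = \<delta>" "r \<bullet> y = x \<bullet> a'"
    using ET3_op[OF d'(1,3) d(1,3) d'(6) d(6) d'(7) d(7), of r "Idn C T"] r id
      arr_Idn_left[OF g] pull_Idn[OF d(1,3,6)] d(1) d'(1) by (auto simp: arr_def)
  note aa = arr_Cmp[OF a'(1) a(1)]
  have "x \<bullet> (a' \<bullet> a) = x"
    using arr_Cmp_assoc[OF d(4) a'(1) a(1)] arr_Cmp_assoc[OF r d'(4) a(1)] arr_Cmp_assoc[OF r i d(4)]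
      a a' Suc.prems(5) arr_Idn_left[OF d(4)] by simp
  moreover have "push C (a' \<bullet> a) \<delta> = \<delta>"
    using push_Cmp[OF d(1) d'(1) d(1) d(3) _ _ d(6), of a a'] a a' by (simp add: arr_def)
  ultimately have "is_iso C K K (a' \<bullet> a)" using etriangle_endo_left[OF t(1) aa] by blast
  then obtain w where w: "arr w K K" "w \<bullet> (a' \<bullet> a) = Idn C K" using is_isoE d(1) by metis
  then have "(w \<bullet> a') \<bullet> a = Idn C K" using arr_Cmp_assoc[OF w(1) a'(1) a(1)] by simp
  then show ?case using Suc.IH[OF K(1) L(2) a(1) arr_Cmp[OF w(1) a'(1)]] L(1) by simp
qed simp

lemma length_unique:
  assumes "M \<in> layer m" "M \<in> layer n"
  shows "m = n"
proof -
  have "M \<in> Ob C" using assms Filt_layer_subset_Ob by blast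
  note id = arr_Idn[OF this]
  show ?thesis
    using retract_length_le[OF assms id id] retract_length_le[OF assms(2,1) id id]
      arr_Idn_left[OF id] by simp
qed

text \<open>
  If \<open>y = 0\<close>, the identity of \<open>M\<close> factors through \<open>x\<close>, so that \<open>M\<close> is a retract of an object whose
  length is one less.
\<close>

lemma no_zero_deflation:
  assumes "conflation C L x M y T" "L \<in> Filt C \<X>" "T \<in> \<X>"
  shows "y \<noteq> \<zero>\<^bsub>Hom C M T\<^esub>"
proof
  assume y: "y = \<zero>\<^bsub>Hom C M T\<^esub>"
  obtain k where k: "L \<in> layer k" using assms by (auto simp: Filt_eq_layers)
  have M: "M \<in> layer (Suc k)" using k assms by (auto simp: star_def)
  obtain \<delta> where t: "etriangle C L x M y T \<delta>" using assms by (auto simp: conflation_def)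
  note d = etriangleD[OF t]
  note id = arr_Idn[OF d(2)]
  have "y \<bullet> Idn C M = \<zero>\<^bsub>Hom C M T\<^esub>" using y arr_Idn_right[OF d(5)] by simp
  then obtain v where "arr v M L" "x \<bullet> v = Idn C M" using weak_kernel[OF t id] by blast
  then have "Suc k \<le> k" using retract_length_le[OF M k _ d(4)] by blast
  then show False by simp
qed

section \<open>Every morphism between filtered objects is admissible\<close>

abbreviation \<D> where
  "\<D> \<equiv> full_sub C (Filt C \<X>)"

lemma conflation_D:
  "conflation \<D> A x B y Z \<longleftrightarrow> A \<in> Filt C \<X> \<and> B \<in> Filt C \<X> \<and> Z \<in> Filt C \<X> \<and> conflation C A x B y Z"
  by (rule conflation_full_sub[OF Filt_subset_Ob])

lemma admissible_iso:
  assumes "is_iso C A B f" "A \<in> Filt C \<X>" "B \<in> Filt C \<X>"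
  shows "admissible \<D> A B f"
proof -
  have ob: "A \<in> Ob C" "B \<in> Ob C" using assms Filt_subset_Ob by auto
  obtain O' where o: "is_zero C O'" by (rule zero_objectE)
  have "conflation C O' \<zero>\<^bsub>Hom C O' A\<^esub> A f B"
    using zero_to_iso_etriangle[OF assms(1) ob(2,1) o] by (auto simp: conflation_def)
  then have "deflation \<D> A B f"
    using is_zero_in_Filt[OF o] assms(2,3) unfolding deflation_def conflation_D by blast
  moreover have "inflation \<D> B B (Idn C B)"
    using conflation_Idn_zero[OF ob(2) o] is_zero_in_Filt[OF o] assms(3)
    by (auto simp: inflation_def conflation_D)
  moreover have "f = Idn C B \<bullet> f" using arr_Idn_left[of f A B] assms(1) ob by (simp add: is_iso_def arr_def)
  ultimately show ?thesis unfolding admissible_def by auto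
qed

lemma admissible_to_zero:
  assumes "arr f A B" "A \<in> Filt C \<X>" "is_zero C B"
  shows "admissible \<D> A B f"
proof -
  have ob: "A \<in> Ob C" "B \<in> Ob C" using assms by (auto simp: arr_def)
  have "deflation \<D> A B f"
    using conflation_Idn_zero[OF ob(1) assms(3)] is_zero_in_Filt[OF assms(3)] assms(2)
      arr_to_zero[OF assms(3,1)]
    by (auto simp: deflation_def conflation_D)
  moreover have "inflation \<D> B B (Idn C B)"
    using conflation_Idn_zero[OF ob(2) assms(3)] is_zero_in_Filt[OF assms(3)]
    by (auto simp: inflation_def conflation_D)
  moreover have "f = Idn C B \<bullet> f" using arr_Idn_left[OF assms(1)] by simp
  ultimately show ?thesis unfolding admissible_def by auto
qed

lemma admissible_Cmp_inflation:
  assumes "admissible \<D> A B f" "conflation \<D> B x N y Z"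
  shows "admissible \<D> A N (x \<bullet> f)"
proof -
  obtain I h g K k Q q where I: "conflation \<D> K k A h I" "conflation \<D> I g B q Q" "f = g \<bullet> h"
    using assms(1) by (auto simp: admissible_def deflation_def inflation_def)
  obtain E h' d e where E: "conflation C I (x \<bullet> g) N h' E" "conflation C Q d E e Z"
    using conflation_ET4[of I g B q Q x N y Z] I(2) assms(2) unfolding conflation_D by metis
  have "E \<in> Filt C \<X>" using Filt_extension[OF E(2)] I(2) assms(2) by (auto simp: conflation_D)
  then have "inflation \<D> I N (x \<bullet> g)"
    using E I(2) assms(2) by (auto simp: inflation_def conflation_D)
  moreover have "x \<bullet> f = (x \<bullet> g) \<bullet> h"
    using I assms(2) arr_Cmp_assoc[of x B N g I h A] conflationD by (auto simp: conflation_D)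
  moreover have "deflation \<D> A I h" using I by (auto simp: deflation_def)
  ultimately show ?thesis unfolding admissible_def by auto
qed

lemma admissible_Cmp_deflation:
  assumes "admissible \<D> A B f" "conflation \<D> L' x M y A"
  shows "admissible \<D> M B (f \<bullet> y)"
proof -
  obtain I h g L k Q q where I: "conflation \<D> L k A h I" "conflation \<D> I g B q Q" "f = g \<bullet> h"
    using assms(1) by (auto simp: admissible_def deflation_def inflation_def)
  obtain E h' d e where E: "conflation C E h' M (h \<bullet> y) I" "conflation C L' d E e L"
    using conflation_ET4_op[of L' x M y A L k h I] I(1) assms(2) unfolding conflation_D by metis
  have "E \<in> Filt C \<X>" using Filt_extension[OF E(2)] I(1) assms(2) by (auto simp: conflation_D)
  then have "deflation \<D> M I (h \<bullet> y)"
    using E I(1) assms(2) by (auto simp: deflation_def conflation_D)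
  moreover have "f \<bullet> y = g \<bullet> (h \<bullet> y)"
    using I assms(2) arr_Cmp_assoc[of g I B h A y M] conflationD by (auto simp: conflation_D)
  moreover have "inflation \<D> I B g" using I by (auto simp: inflation_def)
  ultimately show ?thesis unfolding admissible_def by auto
qed

text \<open>
  Induction on the sum of the lengths of \<open>M\<close> and \<open>N\<close>, as sketched at the beginning.
\<close>

lemma admissible_in_Filt:
  assumes "M \<in> layer m" "N \<in> layer n" "arr f M N"
  shows "admissible \<D> M N f"
  using assms
proof (induction "m + n" arbitrary: m n M N f rule: less_induct)
  case less
  note f = less.prems(3)
  have ob: "M \<in> Ob C" "N \<in> Ob C" using f by (auto simp: arr_def)
  have MN: "M \<in> Filt C \<X>" "N \<in> Filt C \<X>" using less.prems layer_Filt by auto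
  show ?case
  proof (cases "is_zero C N")
    case True
    then show ?thesis using admissible_to_zero[OF f MN(1)] by blast
  next
    case False
    show ?thesis
    proof (cases "\<exists>T \<in> \<X>. \<exists>t. arr t N T \<and> t \<noteq> \<zero>\<^bsub>Hom C N T\<^esub> \<and> t \<bullet> f = \<zero>\<^bsub>Hom C M T\<^esub>")
      case True
      then obtain T t where t: "T \<in> \<X>" "arr t N T" "t \<noteq> \<zero>\<^bsub>Hom C N T\<^esub>" "t \<bullet> f = \<zero>\<^bsub>Hom C M T\<^esub>"
        by blast
      obtain n' N1 x where N1: "n = Suc n'" "N1 \<in> layer n'" "conflation C N1 x N t T"
        using deflation_onto_generator[OF semibrick t(1) less.prems(2) t(2,3)] by blast
      obtain v where v: "arr v M N1" "x \<bullet> v = f"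
        using N1(3) weak_kernel[OF _ f t(4)] unfolding conflation_def by metis
      have "admissible \<D> M N1 v" using less.hyps[OF _ less.prems(1) N1(2) v(1)] N1(1) by simp
      moreover have "conflation \<D> N1 x N t T"
        using N1 MN layer_Filt X_Filt t(1) by (auto simp: conflation_D)
      ultimately show ?thesis using admissible_Cmp_inflation v(2) by metis
    next
      case False
      then have inj: "\<And>T t. \<lbrakk>T \<in> \<X>; arr t N T; t \<bullet> f = \<zero>\<^bsub>Hom C M T\<^esub>\<rbrakk> \<Longrightarrow> t = \<zero>\<^bsub>Hom C N T\<^esub>"
        by blast
      obtain T t where t: "T \<in> \<X>" "arr t N T" "t \<noteq> \<zero>\<^bsub>Hom C N T\<^esub>"
        using nonzero_morphism_to_generator[OF less.prems(2) \<open>\<not> is_zero C N\<close>] by blast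
      have T: "T \<in> Ob C" using t by (simp add: arr_def)
      note tf = arr_Cmp[OF t(2) f]
      have tf0: "t \<bullet> f \<noteq> \<zero>\<^bsub>Hom C M T\<^esub>" using inj t by blast
      obtain n' N1 x' where N1: "n = Suc n'" "N1 \<in> layer n'" "conflation C N1 x' N t T"
        using deflation_onto_generator[OF semibrick t(1) less.prems(2) t(2,3)] by blast
      obtain m' M1 x where M1: "m = Suc m'" "M1 \<in> layer m'" "conflation C M1 x M (t \<bullet> f) T"
        using deflation_onto_generator[OF semibrick t(1) less.prems(1) tf tf0] by blast
      obtain \<delta> \<delta>' where tr: "etriangle C M1 x M (t \<bullet> f) T \<delta>" "etriangle C N1 x' N t T \<delta>'"
        using M1 N1 by (auto simp: conflation_def)
      note d = etriangleD[OF tr(1)] and d' = etriangleD[OF tr(2)]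
      note id = arr_Idn[OF T]
      obtain c where c: "arr c M1 N1" "push C c \<delta> = \<delta>'" "f \<bullet> x = x' \<bullet> c"
        using ET3_op[OF d(1,3) d'(1,3) d(6) d'(6) d(7) d'(7), of f "Idn C T"] f id
          arr_Idn_left[OF tf] pull_Idn[OF d'(1,3,6)] d(1) d'(1) by (auto simp: arr_def)
      have "admissible \<D> M1 N1 c" using less.hyps[OF _ M1(2) N1(2) c(1)] M1 N1 by simp
      then obtain I h g K k Q q where
        I: "conflation \<D> K k M1 h I" "conflation \<D> I g N1 q Q" "c = g \<bullet> h"
        by (auto simp: admissible_def deflation_def inflation_def)
      then have IC: "conflation C K k M1 h I" "conflation C I g N1 q Q"
          "K \<in> Filt C \<X>" "I \<in> Filt C \<X>" "Q \<in> Filt C \<X>" by (auto simp: conflation_D)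
      then obtain \<delta>K \<delta>Q where tI: "etriangle C K k M1 h I \<delta>K" "etriangle C I g N1 q Q \<delta>Q"
        by (auto simp: conflation_def)
      note dK = etriangleD[OF tI(1)] and dQ = etriangleD[OF tI(2)]
      \<comment> \<open>a nonzero \<open>s : Q \<rightarrow> T'\<close> gives a deflation \<open>s q : N\<^sub>1 \<rightarrow> T'\<close> killing \<open>c\<close>, nonzero like all such deflations; it extends to \<open>v\<close> on \<open>N\<close>, and correcting
        \<open>v\<close> by a multiple \<open>u t\<close> yields a nonzero morphism \<open>v'\<close> killing \<open>f\<close>\<close>
      have Q0: "is_zero C Q"
      proof (rule ccontr)
        assume "\<not> is_zero C Q"
        moreover obtain p where p: "Q \<in> layer p" using IC by (auto simp: Filt_eq_layers)
        ultimately obtain T' s where s: "T' \<in> \<X>" "arr s Q T'" "s \<noteq> \<zero>\<^bsub>Hom C Q T'\<^esub>"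
          using nonzero_morphism_to_generator by metis
        have T': "T' \<in> Ob C" using s by (simp add: arr_def)
        obtain L y where L: "L \<in> Filt C \<X>" "conflation C L y Q s T'"
          using deflation_onto_generator[OF semibrick s(1) p s(2,3)] layer_Filt by metis
        obtain E x'' u v where E: "conflation C E x'' N1 (s \<bullet> q) T'" "conflation C I u E v L"
          using conflation_ET4_op[OF IC(2) L(2)] by metis
        have "E \<in> Filt C \<X>" using Filt_extension[OF E(2)] IC L by blast
        then have w0: "s \<bullet> q \<noteq> \<zero>\<^bsub>Hom C N1 T'\<^esub>" using no_zero_deflation[OF E(1)] s(1) by blast
        note w = arr_Cmp[OF s(2) dQ(5)]
        have wg: "(s \<bullet> q) \<bullet> g = \<zero>\<^bsub>Hom C I T'\<^esub>"
          using arr_Cmp_assoc[OF s(2) dQ(5,4)] etriangle_Cmp_zero[OF tI(2)] Cmp_zero[OF s(2) dQ(1)]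
          by simp
        have wc: "(s \<bullet> q) \<bullet> c = \<zero>\<^bsub>Hom C M1 T'\<^esub>"
          unfolding I(3) using arr_Cmp_assoc[OF w dQ(4) dK(5)] wg zero_Cmp[OF dK(5) T'] by simp
        then have "push C (s \<bullet> q) \<delta>' = \<zero>\<^bsub>Ext C T T'\<^esub>"
          using push_Cmp[OF d(1) d'(1) T' T _ _ d(6), of c "s \<bullet> q"] c w
            push_zero_map[OF d(1) T' T d(6)] by (simp add: arr_def)
        then obtain v where v: "arr v N T'" "v \<bullet> x' = s \<bullet> q"
          using extend_along_inflation[OF tr(2) w] by blast
        note vf = arr_Cmp[OF v(1) f]
        have "(v \<bullet> f) \<bullet> x = \<zero>\<^bsub>Hom C M1 T'\<^esub>"
          using arr_Cmp_assoc[OF v(1) f d(4)] c(3) arr_Cmp_assoc[OF v(1) d'(4) c(1)] v(2) wc by simp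
        then obtain u where u: "arr u T T'" "u \<bullet> (t \<bullet> f) = v \<bullet> f"
          using weak_cokernel[OF tr(1) vf] by blast
        note ut = arr_Cmp[OF u(1) t(2)]
        define v' where "v' = v \<ominus>\<^bsub>Hom C N T'\<^esub> u \<bullet> t"
        have v': "arr v' N T'" unfolding v'_def by (rule arr_diff[OF v(1) ut])
        have "v' \<bullet> f = \<zero>\<^bsub>Hom C M T'\<^esub>"
          unfolding v'_def using diff_Cmp[OF v(1) ut f] arr_Cmp_assoc[OF u(1) t(2) f] u(2)
            arr_diff_eq_zero_iff[OF vf vf] by simp
        then have "v' = \<zero>\<^bsub>Hom C N T'\<^esub>" using inj[OF s(1) v'] by blast
        moreover have "v' \<bullet> x' = s \<bullet> q"
          unfolding v'_def using diff_Cmp[OF v(1) ut d'(4)] arr_Cmp_assoc[OF u(1) t(2) d'(4)] v(2)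
            etriangle_Cmp_zero[OF tr(2)] Cmp_zero[OF u(1) d'(1)] arr_diff_zero[OF w] by simp
        ultimately show False using w0 zero_Cmp[OF d'(4) T'] by simp
      qed
      show ?thesis
      proof (cases "is_zero C K")
        case False
        obtain p where p: "K \<in> layer p" using IC by (auto simp: Filt_eq_layers)
        obtain i where i: "I \<in> layer i" using IC by (auto simp: Filt_eq_layers)
        have "p \<noteq> 0" using False p by (cases p) auto
        moreover have "p + i = m'"
          using length_unique[OF Filt_layer_extension[OF IC(1) p i] M1(2)] .
        \<comment> \<open>uniqueness of length makes the cone \<open>E\<close> of \<open>K \<rightarrow> M\<close> shorter than \<open>M\<close>\<close>
        ultimately have less: "Suc i + n < m + n" using M1(1) by simp
        obtain E y u v where E: "conflation C K (x \<bullet> k) M y E" "conflation C I u E v T"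
          using conflation_ET4[OF IC(1) M1(3)] by metis
        have Ei: "E \<in> layer (Suc i)" using E(2) i t(1) by (auto simp: star_def)
        have "f \<bullet> (x \<bullet> k) = x' \<bullet> (g \<bullet> (h \<bullet> k))"
          using arr_Cmp_assoc[OF f d(4) dK(4)] c(3) arr_Cmp_assoc[OF d'(4) c(1) dK(4)] I(3)
            arr_Cmp_assoc[OF dQ(4) dK(5,4)] by simp
        also have "\<dots> = \<zero>\<^bsub>Hom C K N\<^esub>"
          using etriangle_Cmp_zero[OF tI(1)] Cmp_zero[OF dQ(4) dK(1)] Cmp_zero[OF d'(4) dK(1)] by simp
        finally obtain f' where f': "arr f' E N" "f' \<bullet> y = f"
          using E(1) weak_cokernel[OF _ f] unfolding conflation_def by metis
        have "admissible \<D> E N f'" using less.hyps[OF less Ei less.prems(2) f'(1)] .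
        moreover have "conflation \<D> K (x \<bullet> k) M y E"
          using E IC MN layer_Filt[OF Ei] by (auto simp: conflation_D)
        ultimately show ?thesis using admissible_Cmp_deflation f'(2) by metis
      next
        case True
        have "is_iso C M1 N1 c"
          unfolding I(3) using is_iso_Cmp[OF iso_if_zero_cocone[OF IC(1) True]
            iso_if_zero_cone[OF IC(2) Q0] dK(2,3) dQ(2)] .
        moreover have "push C c \<delta> = pull C (Idn C T) \<delta>'" using c(2) pull_Idn[OF d'(1,3,6)] by simp
        moreover have "Idn C T \<bullet> (t \<bullet> f) = t \<bullet> f" using arr_Idn_left[OF tf] .
        ultimately have "is_iso C M N f"
          using etriangle_five[OF tr _ is_iso_Idn[OF T] _ f c(3)] by blast
        then show ?thesis using admissible_iso MN by blast
      qed
    qed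
  qed
qed

end

section \<open>The correspondence\<close>

context simple_semibrick
begin

text \<open>
  The top factor \<open>Z\<close> of a filtration of a simple object is nonzero, so the cocone vanishes and the
  object is isomorphic to \<open>Z\<close>.
\<close>

lemma sim_Filt: "sim \<D> = \<X>"
proof (intro equalityI subsetI)
  fix M assume "M \<in> sim \<D>"
  then have M: "M \<in> Filt C \<X>" "\<not> is_zero C M"
      "\<And>A x y B. conflation \<D> A x M y B \<Longrightarrow> is_zero C A \<or> is_zero C B"
    unfolding sim_def is_simple_def is_zero_full_sub[OF Filt_subset_Ob] by (auto simp: conflation_D)
  obtain n where n: "M \<in> layer n" using M by (auto simp: Filt_eq_layers)
  then obtain k L Z x y where L: "L \<in> layer k" "Z \<in> \<X>" "conflation C L x M y Z"
    using M(2) by (cases n) (auto simp: star_def)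
  then have "is_zero C L \<or> is_zero C Z"
    using M(1,3) layer_Filt X_Filt unfolding conflation_D by blast
  then have "is_zero C L" using brick_nonzero semibrick L(2) by (auto simp: semibrick_def)
  note y = iso_if_zero_cocone[OF L(3) this]
  have "isomorphic C Z M"
    using is_isoE[OF y conflationD(2,3)[OF L(3)]] unfolding isomorphic_def by metis
  then show "M \<in> \<X>" using semibrick L conflationD(2)[OF L(3)] by (auto simp: semibrick_def iso_closed_def)
qed (use simple in \<open>auto simp: simple_set_def\<close>)

lemma wide_Filt: "wide C (Filt C \<X>)"
  unfolding wide_def using extension_closed_Filt admissible_in_Filt Filt_subset_Ob
  by (auto simp: Filt_eq_layers arr_def) (metis UN_I UNIV_I Filt_layer_subset_Ob subsetD)+

end

context extriangulated_category
begin

text \<open>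
  Every step of a filtration with factors in \<open>\<D>\<close> is an extension of objects of \<open>\<D>\<close>, starting from a zero
  object, of which \<open>\<D>\<close> contains all.
\<close>

lemma Filt_full_sub:
  assumes D: "extension_closed C \<D>" and X: "\<X> \<subseteq> \<D>"
  shows "Filt (full_sub C \<D>) \<X> = Filt C \<X>"
proof -
  have ob: "\<D> \<subseteq> Ob C" using D by (auto simp: extension_closed_def iso_closed_def)
  have z: "Z \<in> \<D>" if "is_zero C Z" for Z
  proof -
    obtain O' where O': "O' \<in> \<D>" "is_zero C O'" using D by (auto simp: extension_closed_def)
    have o: "O' \<in> Ob C" "Z \<in> Ob C" using O' that by (auto simp: is_zero_iff)
    have "is_iso C O' Z \<zero>\<^bsub>Hom C O' Z\<^esub>"
      using is_isoI[OF arr_zero arr_zero, OF o o(2,1)] Cmp_zero[OF arr_zero o(1), OF o(2,1)]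
        Cmp_zero[OF arr_zero o(2), OF o] O' that by (simp add: is_zero_iff)
    then show ?thesis using D O' o by (auto simp: extension_closed_def iso_closed_def isomorphic_def)
  qed
  have ext: "B \<in> \<D>" if "conflation C A x B y Z" "A \<in> \<D>" "Z \<in> \<D>" for A x B y Z
  proof -
    have "B \<in> star C \<D> \<D>" using that unfolding star_def by blast
    then show ?thesis using D by (simp add: extension_closed_def)
  qed
  have "Filt_layer C \<X> n \<subseteq> \<D> \<and> Filt_layer (full_sub C \<D>) \<X> n = Filt_layer C \<X> n" for n
  proof (induction n)
    case 0
    then show ?case using z by (auto simp: is_zero_full_sub[OF ob])
  next
    case (Suc n)
    then have "star C (Filt_layer C \<X> n) \<X> \<subseteq> \<D>" using ext X unfolding star_def by blast
    then show ?case using Suc X unfolding Filt_layer.simps star_def conflation_full_sub[OF ob] by blast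
  qed
  then show ?thesis by (simp add: Filt_eq_layers)
qed

lemma ring_End_ring:
  assumes M: "M \<in> Ob C"
  shows "ring (End_ring C M)"
proof -
  interpret H: abelian_group "Hom C M M" using Hom_abelian_group M by blast
  have "abelian_group (End_ring C M)"
    by (rule abelian_groupI)
      (auto simp: End_ring_def H.a_ac intro: H.l_neg bexI[of _ "\<ominus>\<^bsub>Hom C M M\<^esub> _"])
  moreover have "monoid (End_ring C M)"
    by (rule monoidI)
      (use M in \<open>auto simp: End_ring_def Idn_closed intro: Cmp_closed Cmp_assoc Idn_left Idn_right\<close>)
  ultimately show ?thesis
    by (rule ringI) (use M in \<open>auto simp: End_ring_def intro: Cmp_add_left Cmp_add_right\<close>)
qed

text \<open>
  In an admissible factorization \<open>M \<rightarrow> I \<rightarrow> N\<close> of \<open>f\<close> the object \<open>I\<close> is nonzero, so simplicity of \<open>M\<close> and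
  \<open>N\<close> leaves no room for the cocone and the cone.
\<close>

lemma simple_in_wide_iso:
  assumes D: "wide C \<D>" and M: "M \<in> sim (full_sub C \<D>)" and N: "N \<in> sim (full_sub C \<D>)"
    and f: "arr f M N" "f \<noteq> \<zero>\<^bsub>Hom C M N\<^esub>"
  shows "is_iso C M N f"
proof -
  have ob: "\<D> \<subseteq> Ob C" using D by (auto simp: wide_def extension_closed_def iso_closed_def)
  have sim: "S \<in> \<D>" "conflation C A x S y B \<Longrightarrow> A \<in> \<D> \<Longrightarrow> B \<in> \<D> \<Longrightarrow> is_zero C A \<or> is_zero C B"
    if "S \<in> sim (full_sub C \<D>)" for S A x y B
    using that unfolding sim_def is_simple_def is_zero_full_sub[OF ob] conflation_full_sub[OF ob]
    by auto
  have "admissible (full_sub C \<D>) M N f" using D f sim(1) M N by (auto simp: wide_def arr_def)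
  then obtain I h g L k Q q where
    I: "L \<in> \<D>" "I \<in> \<D>" "Q \<in> \<D>" "conflation C L k M h I" "conflation C I g N q Q" "f = g \<bullet> h"
    by (auto simp: admissible_def deflation_def inflation_def conflation_full_sub[OF ob])
  note h = conflationD[OF I(4)] and g = conflationD[OF I(5)]
  have "\<not> is_zero C I"
    using f(2) arr_to_zero[OF _ h(5)] Cmp_zero[OF g(4) h(2)] I(6) by auto
  then have "is_zero C L" "is_zero C Q" using sim(2)[OF M I(4,1,2)] sim(2)[OF N I(5,2,3)] by auto
  then show ?thesis
    unfolding I(6) using is_iso_Cmp[OF iso_if_zero_cocone[OF I(4)] iso_if_zero_cone[OF I(5)] h(2,3) g(2)]
    by blast
qed

lemma iso_closed_sim:
  assumes D: "iso_closed C \<D>"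
  shows "iso_closed C (sim (full_sub C \<D>))"
  unfolding iso_closed_def
proof (intro conjI ballI impI)
  have ob: "\<D> \<subseteq> Ob C" using D by (auto simp: iso_closed_def)
  show "sim (full_sub C \<D>) \<subseteq> Ob C" using ob by (auto simp: sim_def is_simple_def)
  fix M N assume M: "M \<in> sim (full_sub C \<D>)" "N \<in> Ob C" "isomorphic C M N"
  then obtain f where f: "is_iso C M N f" by (auto simp: isomorphic_def)
  have MD: "M \<in> \<D>" "\<not> is_zero C M"
      "\<And>A x y B. conflation C A x M y B \<Longrightarrow> A \<in> \<D> \<Longrightarrow> B \<in> \<D> \<Longrightarrow> is_zero C A \<or> is_zero C B"
    using M(1) unfolding sim_def is_simple_def is_zero_full_sub[OF ob] conflation_full_sub[OF ob] by auto
  have "N \<in> \<D>" using D MD M by (auto simp: iso_closed_def)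
  obtain g where g: "is_iso C N M g" using is_isoE[OF f _ M(2)] MD(1) ob by blast
  have Mob: "M \<in> Ob C" using MD ob by blast
  have "\<not> is_zero C N" using is_zero_iso[OF _ g Mob] MD by blast
  moreover have "is_zero C A \<or> is_zero C B"
    if "conflation C A x N y B" "A \<in> \<D>" "B \<in> \<D>" for A x y B
    using conflation_iso_mid[OF that(1) g Mob] MD(3) that by metis
  ultimately show "N \<in> sim (full_sub C \<D>)"
    using \<open>N \<in> \<D>\<close> unfolding sim_def is_simple_def is_zero_full_sub[OF ob] conflation_full_sub[OF ob]
    by auto
qed

lemma semibrick_sim_of_wide:
  assumes D: "wide C \<D>"
  shows "semibrick C (sim (full_sub C \<D>))"
proof -
  have iso: "iso_closed C \<D>" using D by (auto simp: wide_def extension_closed_def)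
  then have ob: "\<D> \<subseteq> Ob C" by (auto simp: iso_closed_def)
  have sim: "S \<in> Ob C" "\<not> is_zero C S" if "S \<in> sim (full_sub C \<D>)" for S
    using that ob unfolding sim_def is_simple_def is_zero_full_sub[OF ob] by auto
  have "brick C M" if M: "M \<in> sim (full_sub C \<D>)" for M
  proof -
    note m = sim[OF M]
    have "f \<in> Units (End_ring C M)" if "f \<in> Mor C M M" "f \<noteq> \<zero>\<^bsub>Hom C M M\<^esub>" for f
      using simple_in_wide_iso[OF D M M arrI[OF m(1,1)]] that
      by (auto simp: Units_def End_ring_def is_iso_def)
    moreover have "\<zero>\<^bsub>Hom C M M\<^esub> \<notin> Units (End_ring C M)"
      using m zero_Cmp[OF arrI[OF m(1,1)] m(1)] by (auto simp: Units_def End_ring_def is_zero_iff)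
    ultimately show ?thesis
      using m ring_End_ring[OF m(1)]
      by (auto simp: brick_def division_ring_def is_zero_iff End_ring_def Units_def)
  qed
  moreover have "Mor C M N = {\<zero>\<^bsub>Hom C M N\<^esub>}"
    if "M \<in> sim (full_sub C \<D>)" "N \<in> sim (full_sub C \<D>)" "\<not> isomorphic C M N" for M N
    using simple_in_wide_iso[OF D that(1,2)] that(3) arr_zero[of M N] sim that(1,2)
    by (auto simp: isomorphic_def arr_def)
  ultimately show ?thesis unfolding semibrick_def using iso_closed_sim[OF iso] by blast
qed

lemma Filt_of_simple_semibrick:
  assumes "\<X> \<in> simple_semibricks C"
  shows "Filt C \<X> \<in> length_wide_subcats C" "sim (full_sub C (Filt C \<X>)) = \<X>"
proof -
  interpret simple_semibrick K C \<X>
    using assms extriangulated_category_axioms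
    by (auto simp: simple_semibrick_def simple_semibrick_axioms_def simple_semibricks_def)
  show "sim (full_sub C (Filt C \<X>)) = \<X>" by (rule sim_Filt)
  have "\<X> \<subseteq> Filt C \<X>" using X_Filt by blast
  then have "length_subcat C (Filt C \<X>)"
    using Filt_full_sub[OF extension_closed_Filt] sim_Filt extension_closed_Filt
    by (auto simp: length_subcat_def extension_closed_def)
  then show "Filt C \<X> \<in> length_wide_subcats C" using wide_Filt by (simp add: length_wide_subcats_def)
qed

lemma sim_of_length_wide:
  assumes "\<D> \<in> length_wide_subcats C"
  shows "sim (full_sub C \<D>) \<in> simple_semibricks C" "Filt C (sim (full_sub C \<D>)) = \<D>"
proof -
  have w: "wide C \<D>" "length_subcat C \<D>" using assms by (auto simp: length_wide_subcats_def)
  then have e: "extension_closed C \<D>" by (simp add: wide_def)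
  show F: "Filt C (sim (full_sub C \<D>)) = \<D>"
    using Filt_full_sub[OF e, of "sim (full_sub C \<D>)"] w(2)
    by (auto simp: length_subcat_def sim_def is_simple_def)
  have "simple_set C (sim (full_sub C \<D>))"
    unfolding simple_set_def F using iso_closed_sim w(2) by (simp add: length_subcat_def)
  then show "sim (full_sub C \<D>) \<in> simple_semibricks C"
    using semibrick_sim_of_wide[OF w(1)] by (simp add: simple_semibricks_def)
qed

end

theorem theorem4p1:
  fixes K :: "('k, 'r) ring_scheme"
    and C :: "('o, 'm, 'e, 'k, 'z) extcat_scheme"
  assumes "extriangulated_category K C"
    and "hom_finite K C"
    and "krull_schmidt C"
  shows "bij_betw (\<lambda>\<X>. Filt C \<X>) (simple_semibricks C) (length_wide_subcats C)
    \<and> bij_betw (\<lambda>D. sim (full_sub C D)) (length_wide_subcats C) (simple_semibricks C)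
    \<and> (\<forall>\<X> \<in> simple_semibricks C. sim (full_sub C (Filt C \<X>)) = \<X>)
    \<and> (\<forall>D \<in> length_wide_subcats C. Filt C (sim (full_sub C D)) = D)"
proof -
  interpret extriangulated_category K C by (rule assms(1))
  note X = Filt_of_simple_semibrick and D = sim_of_length_wide
  have "bij_betw (\<lambda>\<X>. Filt C \<X>) (simple_semibricks C) (length_wide_subcats C)"
    by (rule bij_betw_byWitness[where f' = "\<lambda>D. sim (full_sub C D)"]) (use X D in auto)
  moreover have "bij_betw (\<lambda>D. sim (full_sub C D)) (length_wide_subcats C) (simple_semibricks C)"
    by (rule bij_betw_byWitness[where f' = "\<lambda>\<X>. Filt C \<X>"]) (use X D in auto)
  ultimately show ?thesis using X(2) D(2) by blast
qed

end
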